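(* Let $A\in\mathbb{R}^{n\times n}$ and $B\in\mathbb{R}^{n\times m}$ be such that the control system $(A,B)$ is exponentially stabilizable, i.e. there is $K\in\mathbb{R}^{m\times n}$ with $\omega_0(A+BK)<0$. For such a $K$ and for $T>0$ let $\mathcal{K}:L^2(0,T;\mathbb{R}^n)\to L^2(0,T;\mathbb{R}^m)$, $(\mathcal{K}x)(t)=Kx(t)$. Then the feedbacked state operator $$\widetilde{\mathcal{A}}:=\mathcal{A}-\mathcal{B}\mathcal{K}:H^1(0,T;\mathbb{R}^n)\to L^2(0,T;\mathbb{R}^n)\times\mathbb{R}^n,\qquad \widetilde{\mathcal{A}}x=\begin{bmatrix}\tfrac{\mathrm{d}}{\mathrm{d}t}x-(A+BK)x\\ x(0)\end{bmatrix},$$ is bounded and boundedly invertible uniformly with respect to the time horizon $T$: for every $T>0$ it is bounded and boundedly invertible, and there is a constant $c>0$ independent of $T$ with $\|\widetilde{\mathcal{A}}^{-1}\|_{L^2(0,T;\mathbb{R}^n)\times\mathbb{R}^n\to H^1(0,T;\mathbb{R}^n)}\le c$ for all $T>0$.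
   Context: For a real square matrix $F$, $\omega_0(F):=\sup\{\operatorname{Re}\lambda:\lambda\text{ is an eigenvalue of }F\}$. For $T>0$ define $\mathcal{A}:H^1(0,T;\mathbb{R}^n)\to L^2(0,T;\mathbb{R}^n)\times\mathbb{R}^n$ and $\mathcal{B}:L^2(0,T;\mathbb{R}^m)\to L^2(0,T;\mathbb{R}^n)\times\mathbb{R}^n$ by $$\mathcal{A}x=\begin{bmatrix}\tfrac{\mathrm{d}}{\mathrm{d}t}x-Ax\\ x(0)\end{bmatrix},\qquad\mathcal{B}u=\begin{bmatrix}Bu\\ 0\end{bmatrix}.$$ Norms: $\|x\|_{H^1(0,T;\mathbb{R}^n)}^2=\|x\|_{L^2}^2+\|\dot x\|_{L^2}^2$ and $\|(f,x_0)\|^2=\|f\|_{L^2}^2+\|x_0\|_{\mathbb{R}^n}^2$. *)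

theory Defs
  imports "HOL-Analysis.Analysis"
begin

section \<open>Spectral abscissa and stabilizability\<close>

definition eigenvalues :: "real^'n^'n \<Rightarrow> complex set" where
  "eigenvalues F =
     {z. \<exists>v :: complex^'n. v \<noteq> 0 \<and> map_matrix complex_of_real F *v v = z *s v}"

definition \<omega>\<^sub>0 :: "real^'n^'n \<Rightarrow> real" where
  "\<omega>\<^sub>0 F = Sup (Re ` eigenvalues F)"

definition exp_stabilizable :: "real^'n^'n \<Rightarrow> real^'m^'n \<Rightarrow> bool" where
  "exp_stabilizable A B \<longleftrightarrow> (\<exists>K :: real^'n^'m. \<omega>\<^sub>0 (A + B ** K) < 0)"


section \<open>Real normed spaces with explicit carrier\<close>

text \<open>The spaces over \<open>(0,T)\<close> depend on the real number \<open>T\<close>, over which the theorem quantifies,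
  so they are sets with operations rather than types.\<close>

record 'v nvs =
  vs_carrier :: "'v set"
  vs_add :: "'v \<Rightarrow> 'v \<Rightarrow> 'v"
  vs_scale :: "real \<Rightarrow> 'v \<Rightarrow> 'v"
  vs_norm :: "'v \<Rightarrow> real"

definition vs_diff :: "'v nvs \<Rightarrow> 'v \<Rightarrow> 'v \<Rightarrow> 'v" where
  "vs_diff V x y = vs_add V x (vs_scale V (-1) y)"

definition bounded_operator :: "'v nvs \<Rightarrow> 'w nvs \<Rightarrow> ('v \<Rightarrow> 'w) \<Rightarrow> bool" where
  "bounded_operator V W F \<longleftrightarrow>
     F \<in> vs_carrier V \<rightarrow> vs_carrier W \<and>
     (\<forall>x\<in>vs_carrier V. \<forall>y\<in>vs_carrier V. F (vs_add V x y) = vs_add W (F x) (F y)) \<and>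
     (\<forall>a. \<forall>x\<in>vs_carrier V. F (vs_scale V a x) = vs_scale W a (F x)) \<and>
     (\<exists>C. \<forall>x\<in>vs_carrier V. vs_norm W (F x) \<le> C * vs_norm V x)"

definition operator_inv :: "'v nvs \<Rightarrow> ('v \<Rightarrow> 'w) \<Rightarrow> 'w \<Rightarrow> 'v" where
  "operator_inv V F = inv_into (vs_carrier V) F"

definition boundedly_invertible :: "'v nvs \<Rightarrow> 'w nvs \<Rightarrow> ('v \<Rightarrow> 'w) \<Rightarrow> bool" where
  "boundedly_invertible V W F \<longleftrightarrow>
     bij_betw F (vs_carrier V) (vs_carrier W) \<and> bounded_operator W V (operator_inv V F)"

text \<open>The supremum is a real number, hence meaningful only for bounded operators.\<close>

definition operator_norm :: "'v nvs \<Rightarrow> 'w nvs \<Rightarrow> ('v \<Rightarrow> 'w) \<Rightarrow> real" where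
  "operator_norm V W F = (SUP x\<in>{x \<in> vs_carrier V. vs_norm V x \<le> 1}. vs_norm W (F x))"


section \<open>The Lebesgue space \<open>L\<^sup>2(0,T)\<close>\<close>

text \<open>Elements are equivalence classes, modulo equality almost everywhere on \<open>(0,T)\<close>, of functions
  on the real line; the values outside \<open>(0,T)\<close> are irrelevant.\<close>

definition sq_integrable :: "real \<Rightarrow> (real \<Rightarrow> 'a::euclidean_space) set" where
  "sq_integrable T =
     {f \<in> borel_measurable (lebesgue_on {0<..<T}).
        integrable (lebesgue_on {0<..<T}) (\<lambda>t. (norm (f t))\<^sup>2)}"

definition ae_eq :: "real \<Rightarrow> ((real \<Rightarrow> 'a::euclidean_space) \<times> (real \<Rightarrow> 'a)) set" where
  "ae_eq T = {(f, g). f \<in> sq_integrable T \<and> g \<in> sq_integrable T \<and>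
                      (AE t in lebesgue_on {0<..<T}. f t = g t)}"

definition cls :: "real \<Rightarrow> (real \<Rightarrow> 'a::euclidean_space) \<Rightarrow> (real \<Rightarrow> 'a) set" where
  "cls T f = ae_eq T `` {f}"

definition rep :: "(real \<Rightarrow> 'a) set \<Rightarrow> real \<Rightarrow> 'a" where
  "rep X = (SOME f. f \<in> X)"

definition L2 :: "real \<Rightarrow> (real \<Rightarrow> 'a::euclidean_space) set nvs" where
  "L2 T = \<lparr>vs_carrier = sq_integrable T // ae_eq T,
           vs_add = (\<lambda>X Y. cls T (\<lambda>t. rep X t + rep Y t)),
           vs_scale = (\<lambda>a X. cls T (\<lambda>t. a *\<^sub>R rep X t)),
           vs_norm = (\<lambda>X. sqrt (\<integral>t. (norm (rep X t))\<^sup>2 \<partial>lebesgue_on {0<..<T}))\<rparr>"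


section \<open>The Sobolev space \<open>H\<^sup>1(0,T)\<close>\<close>

text \<open>Weak derivatives are taken with respect to test functions in \<open>C\<^sub>c\<^sup>1(0,T)\<close>, as in Brezis,
  \<^emph>\<open>Functional Analysis, Sobolev Spaces and Partial Differential Equations\<close>, Section 8.2;
  smooth test functions give the same space.\<close>

definition test_function :: "real \<Rightarrow> (real \<Rightarrow> real) \<Rightarrow> (real \<Rightarrow> real) \<Rightarrow> bool" where
  "test_function T \<phi> \<phi>' \<longleftrightarrow>
     (\<forall>t. (\<phi> has_real_derivative \<phi>' t) (at t)) \<and> continuous_on UNIV \<phi>' \<and>
     compact (closure {t. \<phi> t \<noteq> 0}) \<and> closure {t. \<phi> t \<noteq> 0} \<subseteq> {0<..<T}"

definition is_weak_deriv ::
  "real \<Rightarrow> (real \<Rightarrow> 'a::euclidean_space) set \<Rightarrow> (real \<Rightarrow> 'a) set \<Rightarrow> bool" where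
  "is_weak_deriv T X G \<longleftrightarrow>
     (\<forall>\<phi> \<phi>'. test_function T \<phi> \<phi>' \<longrightarrow>
        (\<integral>t. \<phi>' t *\<^sub>R rep X t \<partial>lebesgue_on {0<..<T}) =
        - (\<integral>t. \<phi> t *\<^sub>R rep G t \<partial>lebesgue_on {0<..<T}))"

definition weak_deriv ::
  "real \<Rightarrow> (real \<Rightarrow> 'a::euclidean_space) set \<Rightarrow> (real \<Rightarrow> 'a) set" where
  "weak_deriv T X = (THE G. G \<in> vs_carrier (L2 T) \<and> is_weak_deriv T X G)"

definition H1 :: "real \<Rightarrow> (real \<Rightarrow> 'a::euclidean_space) set nvs" where
  "H1 T = (L2 T)\<lparr>vs_carrier := {X \<in> vs_carrier (L2 T). \<exists>G\<in>vs_carrier (L2 T). is_weak_deriv T X G},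
                 vs_norm := (\<lambda>X. sqrt ((vs_norm (L2 T) X)\<^sup>2
                                     + (vs_norm (L2 T) (weak_deriv T X))\<^sup>2))\<rparr>"

text \<open>The point evaluation \<open>x(0)\<close> is that of the representative that is continuous on \<open>[0,T]\<close>.\<close>

definition initial_value :: "real \<Rightarrow> (real \<Rightarrow> 'a::euclidean_space) set \<Rightarrow> 'a" where
  "initial_value T X = (THE v. \<exists>f\<in>X. continuous_on {0..T} f \<and> f 0 = v)"


section \<open>The operators\<close>

definition L2_times :: "real \<Rightarrow> ((real \<Rightarrow> real^'n) set \<times> (real^'n)) nvs" where
  "L2_times T =
     \<lparr>vs_carrier = vs_carrier (L2 T) \<times> UNIV,
      vs_add = (\<lambda>(f, a) (g, b). (vs_add (L2 T) f g, a + b)),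
      vs_scale = (\<lambda>r (f, a). (vs_scale (L2 T) r f, r *\<^sub>R a)),
      vs_norm = (\<lambda>(f, a). sqrt ((vs_norm (L2 T) f)\<^sup>2 + (norm a)\<^sup>2))\<rparr>"

text \<open>Pointwise multiplication by a constant matrix, \<open>(M x)(t) = M x(t)\<close>.\<close>

definition matrix_op :: "real \<Rightarrow> real^'n^'m \<Rightarrow> (real \<Rightarrow> real^'n) set \<Rightarrow> (real \<Rightarrow> real^'m) set" where
  "matrix_op T M X = cls T (\<lambda>t. M *v rep X t)"

definition state_op ::
  "real \<Rightarrow> real^'n^'n \<Rightarrow> (real \<Rightarrow> real^'n) set \<Rightarrow> (real \<Rightarrow> real^'n) set \<times> (real^'n)" where
  "state_op T A X = (vs_diff (L2 T) (weak_deriv T X) (matrix_op T A X), initial_value T X)"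

definition input_op ::
  "real \<Rightarrow> real^'m^'n \<Rightarrow> (real \<Rightarrow> real^'m) set \<Rightarrow> (real \<Rightarrow> real^'n) set \<times> (real^'n)" where
  "input_op T B U = (matrix_op T B U, 0)"

definition feedback_op ::
  "real \<Rightarrow> real^'n^'m \<Rightarrow> (real \<Rightarrow> real^'n) set \<Rightarrow> (real \<Rightarrow> real^'m) set" where
  "feedback_op T K = matrix_op T K"

definition feedbacked_state_op ::
  "real \<Rightarrow> real^'n^'n \<Rightarrow> real^'m^'n \<Rightarrow> real^'n^'m \<Rightarrow>
   (real \<Rightarrow> real^'n) set \<Rightarrow> (real \<Rightarrow> real^'n) set \<times> (real^'n)" where
  "feedbacked_state_op T A B K X =
     vs_diff (L2_times T) (state_op T A X) (input_op T B (feedback_op T K X))"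

end

theory Submission
  imports Defs "HOL-Computational_Algebra.Fundamental_Theorem_Algebra"
begin

text \<open>
  Put \<open>F = A + B K\<close>. The feedbacked state operator sends \<open>x\<close> to \<open>(x' - F x, x(0))\<close>, so to invert it on
  \<open>(f, c)\<close> is to solve \<open>x' = F x + f\<close>, \<open>x(0) = c\<close> on \<open>(0, T)\<close>, and the theorem is an a priori estimate for
  this initial value problem with a constant that does not depend on \<open>T\<close>.

  The uniform constant comes from a Lyapunov form (\<open>lyapunov_form\<close>): a symmetric positive semidefinite
  bilinear form \<open>b\<close> with \<open>2 b x (F x) \<le> - \<parallel>x\<parallel>\<^sup>2\<close>. Along a solution, \<open>b x x\<close> has derivative
  \<open>2 b x (F x) + 2 b x f\<close>, which is at most \<open>- \<parallel>x\<parallel>\<^sup>2 / 2 + 2 M\<^sup>2 \<parallel>f\<parallel>\<^sup>2\<close> when \<open>M\<close> bounds \<open>b\<close>. Integrating over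
  \<open>(0, T)\<close> bounds the \<open>L\<^sup>2\<close> norm of \<open>x\<close>, and then that of \<open>x' = F x + f\<close>, by the norm of \<open>(f, c)\<close>
  (\<open>energy_estimate\<close>). The form is built algebraically, without the matrix exponential: a product of
  factors \<open>F - \<mu>\<close>, with all \<open>\<mu>\<close> eigenvalues of \<open>F\<close>, vanishes, and \<open>b\<close> is a weighted sum of the inner products
  \<open>\<langle>P x, P y\<rangle>\<close> over the partial products \<open>P\<close>.

  All other assertions concern a fixed \<open>T\<close>. Each element of the Sobolev space is the class of exactly one
  function \<open>t \<mapsto> c + \<integral>\<^sub>0\<^sup>t g\<close> with \<open>g\<close> in \<open>L\<^sup>2\<close>, unique up to null sets; its weak derivative is \<open>g\<close> and its
  initial value is \<open>c\<close>. This rests on the lemma of du Bois-Reymond and on integration by parts for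
  indefinite Lebesgue integrals. In these coordinates the operator is explicit
  (\<open>feedbacked_state_op_primitive\<close>). It is injective by the energy estimate and surjective
  because the integrated initial value problem is a Volterra equation (\<open>volterra\<close>).
\<close>

section \<open>A Lyapunov form for a matrix whose eigenvalues have negative real part\<close>

definition poly_act :: "complex^'n^'n \<Rightarrow> complex poly \<Rightarrow> complex^'n \<Rightarrow> complex^'n" where
  "poly_act L p v = (\<Sum>i\<le>degree p. coeff p i *s (((*v) L ^^ i) v))"

lemma poly_act_eq:
  assumes "degree p \<le> N"
  shows "poly_act L p v = (\<Sum>i\<le>N. coeff p i *s (((*v) L ^^ i) v))"
  unfolding poly_act_def
  by (rule sum.mono_neutral_left) (use assms in \<open>auto simp: coeff_eq_0\<close>)

lemma poly_act_linear_factor: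
  "poly_act L ([:-\<mu>, 1:] * q) v = L *v poly_act L q v - \<mu> *s poly_act L q v"
proof -
  let ?P = "\<lambda>i. ((*v) L ^^ i) v"
  have d: "degree ([:-\<mu>, 1:] * q) \<le> Suc (degree q)"
    by (rule order_trans[OF degree_mult_le]) simp
  have c: "coeff ([:-\<mu>, 1:] * q) i = (case i of 0 \<Rightarrow> 0 | Suc j \<Rightarrow> coeff q j) - \<mu> * coeff q i" for i
    by (simp add: coeff_pCons split: nat.split)
  have "poly_act L ([:-\<mu>, 1:] * q) v =
      (\<Sum>i\<le>Suc (degree q). (case i of 0 \<Rightarrow> 0 | Suc j \<Rightarrow> coeff q j) *s ?P i)
      - (\<Sum>i\<le>Suc (degree q). (\<mu> * coeff q i) *s ?P i)"
    unfolding poly_act_eq[OF d] c vec.scale_left_diff_distrib sum_subtractf ..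
  also have "(\<Sum>i\<le>Suc (degree q). (case i of 0 \<Rightarrow> 0 | Suc j \<Rightarrow> coeff q j) *s ?P i)
      = (\<Sum>i\<le>degree q. coeff q i *s (L *v ?P i))"
    by (subst sum.atMost_Suc_shift) simp
  also have "\<dots> = L *v poly_act L q v"
    by (simp add: poly_act_def vec.sum vec.scale)
  also have "(\<Sum>i\<le>Suc (degree q). (\<mu> * coeff q i) *s ?P i) = \<mu> *s poly_act L q v"
    by (subst poly_act_eq[of q "Suc (degree q)"])
       (simp_all add: vec.scale_sum_right vec.scale_right_distrib)
  finally show ?thesis .
qed

text \<open>Powers of \<open>L\<close> live in a space of finite real dimension, so enough of them are linearly dependent;
  a dependency is a polynomial, here even with real coefficients.\<close>

lemma annihilating_poly:
  fixes L :: "complex^'n^'n"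
  obtains p where "p \<noteq> 0" "\<And>v. poly_act L p v = 0"
proof -
  define W where "W = (\<lambda>i::nat. ((**) L ^^ i) (mat 1))"
  have W: "W i *v v = ((*v) L ^^ i) v" for i v
    by (induction i) (simp_all add: W_def matrix_vector_mul_assoc[symmetric])
  define N where "N = DIM(complex^'n^'n)"
  have "\<exists>c :: nat \<Rightarrow> real. (\<exists>i\<le>N. c i \<noteq> 0) \<and> (\<Sum>i\<le>N. c i *\<^sub>R W i) = 0"
  \<comment> \<open>dependence of a set says nothing about repeated powers, which give a dependency by themselves\<close>
  proof (cases "inj_on W {..N}")
    case True
    then have "card (W ` {..N}) = N + 1" by (simp add: card_image)
    then have "dependent (W ` {..N})" by (intro dependent_biggerset) (simp add: N_def)
    then obtain u where u: "\<exists>v\<in>W ` {..N}. u v \<noteq> 0" "(\<Sum>v\<in>W ` {..N}. u v *\<^sub>R v) = 0"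
      using dependent_finite[of "W ` {..N}"] by auto
    show ?thesis
      by (rule exI[of _ "u \<circ> W"]) (use u True in \<open>auto simp: sum.reindex\<close>)
  next
    case False
    then obtain i j where ij: "i \<le> N" "j \<le> N" "i \<noteq> j" "W i = W j"
      by (auto simp: inj_on_def)
    let ?c = "\<lambda>k. (if k = i then 1 else 0) - (if k = j then 1 else 0) :: real"
    have "(\<Sum>k\<le>N. ?c k *\<^sub>R W k) = W i - W j"
      using ij(1,2) by (simp add: scaleR_left_diff_distrib sum_subtractf if_distrib[of "\<lambda>a. a *\<^sub>R _"] cong: if_cong)
    then show ?thesis using ij by (intro exI[of _ ?c]) auto
  qed
  then obtain c i where c: "i \<le> N" "c i \<noteq> (0::real)" "(\<Sum>i\<le>N. c i *\<^sub>R W i) = 0" by blast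
  define p where "p = (\<Sum>i\<le>N. monom (complex_of_real (c i)) i)"
  have cp: "coeff p k = (if k \<le> N then complex_of_real (c k) else 0)" for k
    by (simp add: p_def coeff_sum sum.delta)
  have "p \<noteq> 0" using cp[of i] c by auto
  moreover have "poly_act L p v = 0" for v
  proof -
    have "degree p \<le> N" by (rule degree_le) (simp add: cp)
    then have "poly_act L p v = (\<Sum>i\<le>N. complex_of_real (c i) *s (W i *v v))"
      by (subst poly_act_eq) (auto simp: cp W)
    also have "\<dots> = (\<Sum>i\<le>N. c i *\<^sub>R W i) *v v"
      by (simp add: vec_eq_iff matrix_vector_mult_def sum_distrib_right sum_distrib_left sum.swap[of _ _ "{..N}"] mult.assoc scaleR_conv_of_real[where 'a=complex])
    finally show ?thesis using c by simp
  qed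
  ultimately show thesis using that by blast
qed

fun factor_prod :: "complex^'n^'n \<Rightarrow> complex list \<Rightarrow> complex^'n \<Rightarrow> complex^'n" where
  "factor_prod L [] v = v"
| "factor_prod L (\<mu> # \<mu>s) v = L *v factor_prod L \<mu>s v - \<mu> *s factor_prod L \<mu>s v"

lemma factor_prod_linear:
  "factor_prod L \<mu>s (x + y) = factor_prod L \<mu>s x + factor_prod L \<mu>s y"
  "factor_prod L \<mu>s (c *s x) = c *s factor_prod L \<mu>s x"
  "factor_prod L \<mu>s (L *v x) = L *v factor_prod L \<mu>s x"
  by (induction \<mu>s)
     (simp_all add: matrix_vector_right_distrib matrix_vector_mult_diff_distrib
       vec.scale_right_distrib vec.scale_right_diff_distrib vector_scalar_commute mult.commute)

lemma factor_prod_diff: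
  "factor_prod L \<mu>s (x - y) = factor_prod L \<mu>s x - factor_prod L \<mu>s y"
  using factor_prod_linear(1)[of L \<mu>s "x - y" y] by simp

lemma factor_prod_bounded_linear: "bounded_linear (factor_prod L \<mu>s)"
proof (rule linear_conv_bounded_linear[THEN iffD1], rule linearI)
  have *: "r *\<^sub>R z = complex_of_real r *s z" for r and z :: "complex^'a"
    by (simp add: vec_eq_iff scaleR_conv_of_real[where 'a=complex])
  show "factor_prod L \<mu>s (r *\<^sub>R x) = r *\<^sub>R factor_prod L \<mu>s x" for r x
    unfolding * by (rule factor_prod_linear)
qed (rule factor_prod_linear)

definition eigval :: "complex^'n^'n \<Rightarrow> complex \<Rightarrow> bool" where
  "eigval L \<mu> \<longleftrightarrow> (\<exists>v. v \<noteq> 0 \<and> L *v v = \<mu> *s v)"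

text \<open>Factor an annihilating polynomial over the complex numbers. A factor \<open>L - \<mu>\<close> commutes with all the
  others and is injective unless \<open>\<mu>\<close> is an eigenvalue, so every factor that does not come from an
  eigenvalue can be cancelled from the vanishing product. The induction splits off one root at a time:
  \<open>\<nu>s\<close> are the eigenvalues kept so far and \<open>p\<close> is the part that is still to be factored.\<close>

lemma eigenvalue_factors_annihilate:
  fixes L :: "complex^'n^'n"
  obtains \<mu>s where "\<forall>\<mu>\<in>set \<mu>s. eigval L \<mu>" "\<And>v. factor_prod L \<mu>s v = 0"
proof -
  have "\<exists>\<mu>s. (\<forall>\<mu>\<in>set \<mu>s. eigval L \<mu>) \<and> (\<forall>v. factor_prod L \<mu>s v = 0)"
    if "p \<noteq> 0" "\<forall>\<mu>\<in>set \<nu>s. eigval L \<mu>" "\<And>v. factor_prod L \<nu>s (poly_act L p v) = 0" for p \<nu>s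
    using that
  proof (induction "degree p" arbitrary: p \<nu>s)
    case 0
    then obtain a where "p = [:a:]" "a \<noteq> 0" by (metis degree_eq_zeroE pCons_0_0)
    then have "poly_act L p v = a *s v" for v by (simp add: poly_act_def)
    then have "factor_prod L \<nu>s v = 0" for v
      using 0(4)[of v] \<open>a \<noteq> 0\<close> by (simp add: factor_prod_linear)
    then show ?case using 0 by blast
  next
    case (Suc n)
    then have "\<not> constant (poly p)" by (simp add: constant_degree)
    then obtain \<mu> where "poly p \<mu> = 0" using fundamental_theorem_of_algebra by blast
    then obtain q where q: "p = [:-\<mu>, 1:] * q" by (auto simp: poly_eq_0_iff_dvd)
    have "q \<noteq> 0" using Suc q by auto
    have "n = degree q"
      using Suc(2) \<open>q \<noteq> 0\<close> unfolding q by (subst (asm) degree_mult_eq) auto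
    have z: "factor_prod L (\<mu> # \<nu>s) (poly_act L q v) = 0" for v
      using Suc(5)[of v] unfolding q poly_act_linear_factor
      by (simp add: factor_prod_diff factor_prod_linear)
    show ?case
    proof (cases "eigval L \<mu>")
      case True
      then show ?thesis using Suc(1)[OF \<open>n = degree q\<close> \<open>q \<noteq> 0\<close> _ z] Suc(4) by auto
    next
      case False
      have "factor_prod L \<nu>s (poly_act L q v) = 0" for v
        using z[of v] False unfolding eigval_def by force
      then show ?thesis using Suc(1)[OF \<open>n = degree q\<close> \<open>q \<noteq> 0\<close> Suc(4)] by blast
    qed
  qed
  moreover obtain p where "p \<noteq> 0" "\<And>v. poly_act L p v = 0" using annihilating_poly[of L] by blast
  ultimately show thesis using that[of] by (metis empty_iff factor_prod.simps(1) list.set(1))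
qed

lemma inner_complex_scale: "inner y (\<mu> *s y) = Re \<mu> * (norm y)\<^sup>2" for y :: "complex^'n"
  unfolding power2_norm_eq_inner
  by (simp add: inner_vec_def inner_complex_def sum_distrib_left algebra_simps)

text \<open>The form is \<open>b u v = \<Sum>\<^sub>k c\<^sub>k \<langle>P\<^sub>k u, P\<^sub>k v\<rangle>\<close>, summed over the partial products \<open>P\<^sub>k\<close>. With \<open>y = P\<^sub>k x\<close>
  and \<open>z = P\<^bsub>k+1\<^esub> x\<close> one has \<open>P\<^sub>k (L x) = L y = \<mu> y + z\<close>, so the \<open>k\<close>-th term of the form contributes
  to \<open>2 b x (L x)\<close> at most \<open>- d \<parallel>y\<parallel>\<^sup>2 + \<parallel>z\<parallel>\<^sup>2 / d\<close>, times its weight, where \<open>d = - Re \<mu>\<close>. It absorbs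
  the error left by the shorter product at the price of an error in the longer one.\<close>

lemma lyapunov_form_modulo_product:
  fixes L :: "complex^'n^'n"
  assumes "\<forall>\<mu>\<in>set \<mu>s. Re \<mu> < 0"
  shows "\<exists>b C. bounded_bilinear b \<and> (\<forall>x y. b x y = b y x) \<and> (\<forall>x. 0 \<le> b x x) \<and> 0 \<le> (C::real) \<and>
    (\<forall>x. 2 * b x (L *v x) \<le> - (norm x)\<^sup>2 + C * (norm (factor_prod L \<mu>s x))\<^sup>2)"
  using assms
proof (induction \<mu>s)
  case Nil
  show ?case
    by (rule exI[of _ "\<lambda>_ _. 0"], rule exI[of _ 1]) (auto simp: bounded_bilinear_def intro: exI[of _ 0])
next
  case (Cons \<mu> \<mu>s)
  then obtain b C where b: "bounded_bilinear b" "\<And>x y. b x y = b y x" "\<And>x. 0 \<le> b x x" "0 \<le> (C::real)"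
    "\<And>x. 2 * b x (L *v x) \<le> - (norm x)\<^sup>2 + C * (norm (factor_prod L \<mu>s x))\<^sup>2"
    by auto
  define d where "d = - Re \<mu>"
  have d: "d > 0" using Cons by (simp add: d_def)
  let ?P = "factor_prod L \<mu>s"
  \<comment> \<open>the weight makes the gain \<open>(C / d) d \<parallel>y\<parallel>\<^sup>2\<close> equal to the error \<open>C \<parallel>y\<parallel>\<^sup>2\<close> of the shorter product\<close>
  define b' where "b' = (\<lambda>x y. b x y + (C / d) * inner (?P x) (?P y))"
  interpret b: bounded_bilinear b by fact
  interpret P: bounded_linear ?P by (rule factor_prod_bounded_linear)
  have "bounded_bilinear b'"
    unfolding bilinear_conv_bounded_bilinear[symmetric] bilinear_def b'_def
    by (auto intro!: linearI simp: b.add_left b.add_right b.scaleR_left b.scaleR_right P.add P.scaleR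
        inner_add_left inner_add_right algebra_simps add_divide_distrib)
  moreover have "2 * b' x (L *v x) \<le> - (norm x)\<^sup>2 + (C / d\<^sup>2) * (norm (factor_prod L (\<mu> # \<mu>s) x))\<^sup>2" for x
  proof -
    define y where "y = ?P x"
    define z where "z = factor_prod L (\<mu> # \<mu>s) x"
    have "L *v y = \<mu> *s y + z" by (simp add: z_def y_def)
    then have "inner y (L *v y) = - d * (norm y)\<^sup>2 + inner y z"
      by (simp add: inner_add_right inner_complex_scale d_def)
    moreover have "inner y z \<le> norm y * norm z" by (rule norm_cauchy_schwarz)
    moreover have "2 * (norm y * norm z) \<le> d * (norm y)\<^sup>2 + (norm z)\<^sup>2 / d"
    proof -
      have "0 \<le> (d * norm y - norm z)\<^sup>2 / d" using d by simp
      also have "\<dots> = d * (norm y)\<^sup>2 + (norm z)\<^sup>2 / d - 2 * (norm y * norm z)"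
        using d by (simp add: power2_eq_square field_simps)
      finally show ?thesis by simp
    qed
    ultimately have "2 * inner y (L *v y) \<le> - d * (norm y)\<^sup>2 + (norm z)\<^sup>2 / d" by simp
    then have "(C / d) * (2 * inner y (L *v y)) \<le> (C / d) * (- d * (norm y)\<^sup>2 + (norm z)\<^sup>2 / d)"
      by (rule mult_left_mono) (use d b(4) in simp)
    also have "\<dots> = - C * (norm y)\<^sup>2 + (C / d\<^sup>2) * (norm z)\<^sup>2"
      using d by (simp add: power2_eq_square field_simps)
    finally show ?thesis
      using b(5)[of x] unfolding b'_def z_def[symmetric] factor_prod_linear(3) y_def[symmetric]
      by (simp add: algebra_simps)
  qed
  moreover have "0 \<le> b' x x" "b' x y = b' y x" for x y
    using b d by (auto simp: b'_def inner_commute)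
  moreover have "0 \<le> C / d\<^sup>2" using b(4) by simp
  ultimately show ?case by blast
qed

text \<open>The supremum bounds each real part only because the spectrum is bounded, namely by the operator norm.\<close>

lemma spectral_abscissa_neg_imp_Re_neg:
  fixes F :: "real^'n^'n"
  assumes "\<omega>\<^sub>0 F < 0" "z \<in> eigenvalues F"
  shows "Re z < 0"
proof -
  let ?L = "map_matrix complex_of_real F"
  have "norm z \<le> onorm ((*v) ?L)" if z: "z \<in> eigenvalues F" for z
  proof -
    obtain v where v: "v \<noteq> 0" "?L *v v = z *s v" using z unfolding eigenvalues_def by blast
    have "norm (z *s v) = norm z * norm v"
      by (simp add: norm_vec_def norm_mult L2_set_right_distrib)
    moreover have "norm (?L *v v) \<le> onorm ((*v) ?L) * norm v"
      by (rule onorm) simp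
    ultimately show ?thesis using v by simp
  qed
  then have "bdd_above (Re ` eigenvalues F)"
    by (intro bdd_aboveI2[where M = "onorm ((*v) ?L)"]) (meson complex_Re_le_cmod order_trans)
  then have "Re z \<le> \<omega>\<^sub>0 F" unfolding \<omega>\<^sub>0_def using assms(2) by (intro cSup_upper) auto
  then show ?thesis using assms(1) by simp
qed

text \<open>For the product that annihilates the complexified matrix the error term vanishes; restricting the
  complex form to real vectors loses nothing.\<close>

lemma lyapunov_form:
  fixes F :: "real^'n^'n"
  assumes "\<omega>\<^sub>0 F < 0"
  obtains b where "bounded_bilinear b" "\<And>x y. b x y = b y x" "\<And>x. 0 \<le> b x x"
    "\<And>x. 2 * b x (F *v x) \<le> - (norm x)\<^sup>2"
proof -
  let ?L = "map_matrix complex_of_real F"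
  obtain \<mu>s where ms: "\<forall>\<mu>\<in>set \<mu>s. eigval ?L \<mu>" "\<And>v. factor_prod ?L \<mu>s v = 0"
    using eigenvalue_factors_annihilate by blast
  then have "\<forall>\<mu>\<in>set \<mu>s. Re \<mu> < 0"
    using spectral_abscissa_neg_imp_Re_neg[OF assms] by (auto simp: eigval_def eigenvalues_def)
  from lyapunov_form_modulo_product[OF this, of ?L] obtain b where b: "bounded_bilinear b" "\<And>x y. b x y = b y x"
    "\<And>x. 0 \<le> b x x" "\<And>x. 2 * b x (?L *v x) \<le> - (norm x)\<^sup>2"
    using ms by auto
  define e where "e = (\<lambda>x :: real^'n. (\<chi> i. complex_of_real (x $ i)) :: complex^'n)"
  have e: "bounded_linear e"
    by (rule linear_conv_bounded_linear[THEN iffD1], rule linearI)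
       (simp_all add: e_def vec_eq_iff scaleR_conv_of_real[where 'a=complex])
  have n: "norm (e x) = norm x" for x by (simp add: e_def norm_vec_def)
  have m: "?L *v e x = e (F *v x)" for x
    by (simp add: e_def vec_eq_iff matrix_vector_mult_def map_matrix_def)
  show thesis
  proof (rule that[of "\<lambda>x y. b (e x) (e y)"])
    show "bounded_bilinear (\<lambda>x y. b (e x) (e y))"
      by (rule bounded_bilinear.comp[OF b(1) e e])
    show "2 * b (e x) (e (F *v x)) \<le> - (norm x)\<^sup>2" for x
      using b(4)[of "e x"] by (simp add: n m)
  qed (use b in auto)
qed

section \<open>Indefinite integrals on a bounded interval\<close>

lemma finite_measure_interval: "finite_measure (lebesgue_on {0<..<T::real})"
  by (intro finite_measure_lebesgue_on) simp

lemma integrable_interval_imp_absolutely: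
  fixes g :: "real \<Rightarrow> 'a::euclidean_space"
  assumes "integrable (lebesgue_on {0<..<T}) g"
  shows "g absolutely_integrable_on {0..T}"
proof -
  have "g absolutely_integrable_on {0<..<T}"
    using assms by (simp add: set_integrable_def integrable_restrict_space)
  then show ?thesis by (simp add: absolutely_integrable_on_Icc_iff_Ioo)
qed

lemma integral_interval_eq:
  fixes g :: "real \<Rightarrow> 'a::euclidean_space"
  assumes "integrable (lebesgue_on {0<..<T}) g"
  shows "(\<integral>t. g t \<partial>lebesgue_on {0<..<T}) = integral {0..T} g"
  using lebesgue_integral_eq_integral[OF assms] by (simp add: integral_open_interval_real)

lemma integrable_on_prefix:
  fixes g :: "real \<Rightarrow> 'a::euclidean_space"
  assumes "integrable (lebesgue_on {0<..<T}) g" "t \<le> T"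
  shows "g integrable_on {0..t}"
  using integrable_interval_imp_absolutely[OF assms(1)] assms(2)
  by (meson absolutely_integrable_on_def integrable_on_subinterval atLeastatMost_subset_iff order_refl)

lemma integrable_restrict_if:
  fixes g :: "'b \<Rightarrow> 'a::euclidean_space"
  assumes "integrable M g" "Measurable.pred M P"
  shows "integrable M (\<lambda>s. if P s then g s else 0)"
  by (rule Bochner_Integration.integrable_bound[OF assms(1)]) (use assms in auto)

lemma measurable_pred_le_lebesgue_on:
  "Measurable.pred (lebesgue_on S) (\<lambda>s. s \<le> (t::real))"
  "Measurable.pred (lebesgue_on S) (\<lambda>s. s < (t::real))"
proof -
  have [measurable]: "(\<lambda>s. s) \<in> borel_measurable (lebesgue_on S)"
    using id_borel_measurable_lebesgue_on[of S] by (simp add: id_def)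
  show "Measurable.pred (lebesgue_on S) (\<lambda>s. s \<le> t)" "Measurable.pred (lebesgue_on S) (\<lambda>s. s < t)"
    by measurable
qed

lemma integral_prefix_eq:
  fixes g :: "real \<Rightarrow> 'a::euclidean_space"
  assumes g: "integrable (lebesgue_on {0<..<T}) g" and t: "t \<in> {0<..<T}"
  shows "(\<integral>s. (if s \<le> t then g s else 0) \<partial>lebesgue_on {0<..<T}) = integral {0..t} g"
    and "(\<integral>s. (if s < t then g s else 0) \<partial>lebesgue_on {0<..<T}) = integral {0..t} g"
proof -
  have "integral {0..T} (\<lambda>s. if s \<le> t then g s else 0) = integral {0..t} g"
    using t by (subst integral_restrict_Int[of _ "{..t}", simplified]) (auto intro!: arg_cong2[where f=integral])
  then show "(\<integral>s. (if s \<le> t then g s else 0) \<partial>lebesgue_on {0<..<T}) = integral {0..t} g"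
    by (simp add: integral_interval_eq integrable_restrict_if[OF g measurable_pred_le_lebesgue_on(1)])
  have "integral {0..T} (\<lambda>s. if s < t then g s else 0) = integral {0..t} g"
    unfolding \<open>integral {0..T} (\<lambda>s. if s \<le> t then g s else 0) = integral {0..t} g\<close>[symmetric]
    by (rule integral_spike[of "{t}"]) auto
  then show "(\<integral>s. (if s < t then g s else 0) \<partial>lebesgue_on {0<..<T}) = integral {0..t} g"
    by (simp add: integral_interval_eq integrable_restrict_if[OF g measurable_pred_le_lebesgue_on(2)])
qed

text \<open>Integration by parts for functions that are differentiable only almost everywhere: the product of the
  two full integrals is, by Fubini, the integral of \<open>\<beta> (g s) (h t)\<close> over the square, and the square
  is the union of the triangles \<open>s \<le> t\<close> and \<open>t < s\<close>.\<close>

lemma integral_by_parts_integrals: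
  fixes g :: "real \<Rightarrow> 'a::euclidean_space" and h :: "real \<Rightarrow> 'b::euclidean_space"
    and \<beta> :: "'a \<Rightarrow> 'b \<Rightarrow> 'c::euclidean_space"
  assumes \<beta>: "bounded_bilinear \<beta>"
    and g: "integrable (lebesgue_on {0<..<T}) g" and h: "integrable (lebesgue_on {0<..<T}) h"
  defines "M \<equiv> lebesgue_on {0<..<T}"
  shows "integrable M (\<lambda>t. \<beta> (integral {0..t} g) (h t))"
    and "integrable M (\<lambda>t. \<beta> (g t) (integral {0..t} h))"
    and "\<beta> (integral {0..T} g) (integral {0..T} h) =
      (\<integral>t. \<beta> (integral {0..t} g) (h t) \<partial>M) + (\<integral>t. \<beta> (g t) (integral {0..t} h) \<partial>M)"
proof -
  interpret \<beta>: bounded_bilinear \<beta> by fact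
  interpret finite_measure M unfolding M_def by (rule finite_measure_interval)
  interpret P: pair_sigma_finite M M by standard
  note [measurable] = borel_measurable_integrable[OF g, folded M_def] borel_measurable_integrable[OF h, folded M_def]
  have id[measurable]: "(\<lambda>s. s) \<in> borel_measurable M"
    using id_borel_measurable_lebesgue_on[of "{0<..<T}"] by (simp add: id_def M_def)
  note g' = g[folded M_def] and h' = h[folded M_def]
  obtain K where K: "K > 0" "\<And>a b. norm (\<beta> a b) \<le> norm a * norm b * K" using \<beta>.pos_bounded by blast
  have "integrable (M \<Otimes>\<^sub>M M) (\<lambda>p. norm (g (fst p)) * norm (h (snd p)) * K)"
  proof (rule P.Fubini_integrable)
    show "AE x in M. integrable M (\<lambda>y. norm (g (fst (x, y))) * norm (h (snd (x, y))) * K)"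
      using h' by auto
    show "integrable M (\<lambda>x. \<integral>y. norm (norm (g (fst (x, y))) * norm (h (snd (x, y))) * K) \<partial>M)"
      using g' h' K(1) by (auto simp: abs_mult)
  qed measurable
  moreover have mb: "(\<lambda>p. \<beta> (g (fst p)) (h (snd p))) \<in> borel_measurable (M \<Otimes>\<^sub>M M)"
    by (rule borel_measurable_continuous_Pair) (auto intro!: \<beta>.continuous_on continuous_intros)
  ultimately have I: "integrable (M \<Otimes>\<^sub>M M) (\<lambda>p. \<beta> (g (fst p)) (h (snd p)))"
    by (rule Bochner_Integration.integrable_bound) (use K in \<open>auto intro!: AE_I2 order_trans[OF K(2)]\<close>)
  have I1: "integrable (M \<Otimes>\<^sub>M M) (\<lambda>(s, t). if s \<le> t then \<beta> (g s) (h t) else 0)"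
    using integrable_restrict_if[OF I, of "\<lambda>p. fst p \<le> snd p"] by (simp add: case_prod_beta')
  have I2: "integrable (M \<Otimes>\<^sub>M M) (\<lambda>(s, t). if t < s then \<beta> (g s) (h t) else 0)"
    using integrable_restrict_if[OF I, of "\<lambda>p. snd p < fst p"] by (simp add: case_prod_beta')
  have sp: "t \<in> space M \<Longrightarrow> t \<in> {0<..<T}" for t by (simp add: M_def)
  have e1: "(\<integral>s. (if s \<le> t then \<beta> (g s) (h t) else 0) \<partial>M) = \<beta> (integral {0..t} g) (h t)"
    if "t \<in> space M" for t
  proof -
    have "(\<integral>s. \<beta> (if s \<le> t then g s else 0) (h t) \<partial>M) = \<beta> (\<integral>s. (if s \<le> t then g s else 0) \<partial>M) (h t)"
      by (rule integral_bounded_linear[OF \<beta>.bounded_linear_left])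
        (use integrable_restrict_if[OF g measurable_pred_le_lebesgue_on(1)] in \<open>simp add: M_def\<close>)
    then show ?thesis
      using integral_prefix_eq(1)[OF g sp[OF that]]
      by (simp add: M_def if_distrib[of "\<lambda>x. \<beta> x _"] \<beta>.zero_left cong: if_cong)
  qed
  have e2: "(\<integral>t. (if t < s then \<beta> (g s) (h t) else 0) \<partial>M) = \<beta> (g s) (integral {0..s} h)"
    if "s \<in> space M" for s
  proof -
    have "(\<integral>t. \<beta> (g s) (if t < s then h t else 0) \<partial>M) = \<beta> (g s) (\<integral>t. (if t < s then h t else 0) \<partial>M)"
      by (rule integral_bounded_linear[OF \<beta>.bounded_linear_right])
        (use integrable_restrict_if[OF h measurable_pred_le_lebesgue_on(2)] in \<open>simp add: M_def\<close>)
    then show ?thesis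
      using integral_prefix_eq(2)[OF h sp[OF that]]
      by (simp add: M_def if_distrib[of "\<lambda>x. \<beta> _ x"] \<beta>.zero_right cong: if_cong)
  qed
  show "integrable M (\<lambda>t. \<beta> (integral {0..t} g) (h t))"
    using P.integrable_snd[OF I1] e1 by (simp cong: Bochner_Integration.integrable_cong)
  show "integrable M (\<lambda>t. \<beta> (g t) (integral {0..t} h))"
    using P.integrable_fst[OF I2] e2 by (simp cong: Bochner_Integration.integrable_cong)
  have "\<beta> (integral {0..T} g) (integral {0..T} h) = (\<integral>s. \<beta> (g s) (integral {0..T} h) \<partial>M)"
    using integral_bounded_linear[OF \<beta>.bounded_linear_left g'] integral_interval_eq[OF g, folded M_def]
    by simp
  also have "\<dots> = (\<integral>s. \<integral>t. \<beta> (g s) (h t) \<partial>M \<partial>M)"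
    using integral_bounded_linear[OF \<beta>.bounded_linear_right h'] integral_interval_eq[OF h, folded M_def]
    by simp
  also have "\<dots> = (\<integral>p. \<beta> (g (fst p)) (h (snd p)) \<partial>(M \<Otimes>\<^sub>M M))"
    using P.integral_fst'[OF I] by simp
  also have "\<dots> = (\<integral>p. (case p of (s, t) \<Rightarrow> if s \<le> t then \<beta> (g s) (h t) else 0)
      + (case p of (s, t) \<Rightarrow> if t < s then \<beta> (g s) (h t) else 0) \<partial>(M \<Otimes>\<^sub>M M))"
    by (intro Bochner_Integration.integral_cong) auto
  also have "\<dots> = (\<integral>p. (case p of (s, t) \<Rightarrow> if s \<le> t then \<beta> (g s) (h t) else 0) \<partial>(M \<Otimes>\<^sub>M M))
      + (\<integral>p. (case p of (s, t) \<Rightarrow> if t < s then \<beta> (g s) (h t) else 0) \<partial>(M \<Otimes>\<^sub>M M))"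
    by (rule Bochner_Integration.integral_add[OF I1 I2])
  also have "(\<integral>p. (case p of (s, t) \<Rightarrow> if s \<le> t then \<beta> (g s) (h t) else 0) \<partial>(M \<Otimes>\<^sub>M M))
     = (\<integral>t. \<beta> (integral {0..t} g) (h t) \<partial>M)"
    using P.integral_snd[OF I1] e1 by (simp cong: Bochner_Integration.integral_cong)
  also have "(\<integral>p. (case p of (s, t) \<Rightarrow> if t < s then \<beta> (g s) (h t) else 0) \<partial>(M \<Otimes>\<^sub>M M))
     = (\<integral>t. \<beta> (g t) (integral {0..t} h) \<partial>M)"
    using P.integral_fst[OF I2] e2 by (simp cong: Bochner_Integration.integral_cong)
  finally show "\<beta> (integral {0..T} g) (integral {0..T} h) =
      (\<integral>t. \<beta> (integral {0..t} g) (h t) \<partial>M) + (\<integral>t. \<beta> (g t) (integral {0..t} h) \<partial>M)" .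
qed

definition primitive :: "'a \<Rightarrow> (real \<Rightarrow> 'a) \<Rightarrow> real \<Rightarrow> 'a::euclidean_space" where
  "primitive c g t = c + integral {0..t} g"

lemma primitive_0 [simp]: "primitive c g 0 = c"
  by (simp add: primitive_def)

text \<open>This rule serves twice: with \<open>\<beta>\<close> the scalar multiplication it identifies weak derivatives, and with \<open>\<beta>\<close>
  a Lyapunov form it is the energy identity.\<close>

lemma integral_by_parts_primitive:
  fixes g :: "real \<Rightarrow> 'a::euclidean_space" and h :: "real \<Rightarrow> 'b::euclidean_space"
    and \<beta> :: "'a \<Rightarrow> 'b \<Rightarrow> 'c::euclidean_space"
  assumes \<beta>: "bounded_bilinear \<beta>"
    and g: "integrable (lebesgue_on {0<..<T}) g" and h: "integrable (lebesgue_on {0<..<T}) h"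
  shows "integrable (lebesgue_on {0<..<T}) (\<lambda>t. \<beta> (primitive c g t) (h t))"
    and "integrable (lebesgue_on {0<..<T}) (\<lambda>t. \<beta> (g t) (primitive d h t))"
    and "\<beta> (primitive c g T) (primitive d h T) - \<beta> c d =
      (\<integral>t. \<beta> (primitive c g t) (h t) \<partial>lebesgue_on {0<..<T})
      + (\<integral>t. \<beta> (g t) (primitive d h t) \<partial>lebesgue_on {0<..<T})"
proof -
  interpret \<beta>: bounded_bilinear \<beta> by fact
  note z = integral_by_parts_integrals[OF \<beta> g h]
  have h1: "integrable (lebesgue_on {0<..<T}) (\<lambda>t. \<beta> c (h t))"
    by (rule integrable_bounded_linear[OF \<beta>.bounded_linear_right h])
  have g1: "integrable (lebesgue_on {0<..<T}) (\<lambda>t. \<beta> (g t) d)"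
    by (rule integrable_bounded_linear[OF \<beta>.bounded_linear_left g])
  show "integrable (lebesgue_on {0<..<T}) (\<lambda>t. \<beta> (primitive c g t) (h t))"
    "integrable (lebesgue_on {0<..<T}) (\<lambda>t. \<beta> (g t) (primitive d h t))"
    using h1 g1 z(1,2) by (simp_all add: primitive_def \<beta>.add_left \<beta>.add_right)
  show "\<beta> (primitive c g T) (primitive d h T) - \<beta> c d =
      (\<integral>t. \<beta> (primitive c g t) (h t) \<partial>lebesgue_on {0<..<T})
      + (\<integral>t. \<beta> (g t) (primitive d h t) \<partial>lebesgue_on {0<..<T})"
    using h1 g1 z integral_bounded_linear[OF \<beta>.bounded_linear_right h, of c]
      integral_bounded_linear[OF \<beta>.bounded_linear_left g, of d]
    by (simp add: primitive_def \<beta>.add_left \<beta>.add_right integral_interval_eq[OF g] integral_interval_eq[OF h])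
qed

lemma continuous_on_primitive:
  assumes "integrable (lebesgue_on {0<..<T}) g"
  shows "continuous_on {0..T} (primitive c g)"
  unfolding primitive_def[abs_def]
  by (intro continuous_intros indefinite_integral_continuous_1 integrable_on_prefix[OF assms] order_refl)

text \<open>By Lebesgue differentiation \<open>g\<close> is almost everywhere the limit of its averages over short intervals.\<close>

lemma AE_zero_if_interval_integrals_zero:
  fixes g :: "real \<Rightarrow> 'a::euclidean_space"
  assumes g: "integrable (lebesgue_on {0<..<T}) g"
    and z: "\<And>a b. 0 < a \<Longrightarrow> a < b \<Longrightarrow> b < T \<Longrightarrow> integral {a..b} g = 0"
  shows "AE t in lebesgue_on {0<..<T}. g t = 0"
proof -
  define f where "f = (\<lambda>t. if t \<in> {0<..<T} then g t else 0)"
  have "g absolutely_integrable_on {0<..<T}"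
    using g by (simp add: set_integrable_def integrable_restrict_space)
  then have "f integrable_on UNIV"
    unfolding f_def integrable_restrict_UNIV by (simp add: absolutely_integrable_on_def)
  then have "f integrable_on cbox a b" for a b
    by (rule integrable_on_subcbox) simp
  then obtain N where N: "negligible N" "\<And>x e. \<lbrakk>x \<notin> N; 0 < e\<rbrakk> \<Longrightarrow>
      \<exists>d>0. \<forall>h. 0 < h \<and> h < d \<longrightarrow> norm (integral (cbox x (x + h *\<^sub>R One)) f /\<^sub>R h ^ DIM(real) - f x) < e"
    using integrable_ccontinuous_explicit[of f] by metis
  have "g x = 0" if x: "x \<in> {0<..<T}" "x \<notin> N" for x
  proof (rule ccontr)
    assume "g x \<noteq> 0"
    then have "norm (g x) > 0" by simp
    from N(2)[OF x(2) this] obtain d where d: "d > 0"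
      "\<And>h. 0 < h \<Longrightarrow> h < d \<Longrightarrow> norm (integral (cbox x (x + h)) f /\<^sub>R h - f x) < norm (g x)" by auto
    define h where "h = min d (T - x) / 2"
    have h: "0 < h" "h < d" "x + h < T" using d x by (auto simp: h_def min_def field_simps)
    have "integral {x..x+h} f = integral {x..x+h} g"
      by (rule integral_cong) (use x h in \<open>auto simp: f_def\<close>)
    also have "\<dots> = 0" using x h by (intro z) auto
    finally show False using d(2)[OF h(1,2)] x by (simp add: f_def)
  qed
  moreover have "AE x in lebesgue. x \<notin> N"
    using N(1) by (simp add: negligible_iff_null_sets AE_not_in)
  ultimately have "AE x in lebesgue. x \<in> {0<..<T} \<longrightarrow> g x = 0" by auto
  then show ?thesis by (simp add: AE_restrict_space_iff)
qed

text \<open>The zero mean is what makes the primitive vanish again to the right of the support of \<open>\<psi>\<close>.\<close>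

lemma test_function_of_mean_zero:
  assumes \<psi>: "continuous_on UNIV \<psi>" and ab: "0 < a" "a \<le> b" "b < T"
    and supp: "\<And>t. t \<notin> {a..b} \<Longrightarrow> \<psi> t = 0" and mean: "integral {0..T} \<psi> = 0"
  shows "test_function T (\<lambda>t. integral {0..t} \<psi>) \<psi>"
proof -
  have int: "\<psi> integrable_on {u..v}" for u v
    by (rule integrable_continuous_real) (rule continuous_on_subset[OF \<psi>], simp)
  have left: "integral {0..t} \<psi> = 0" if "t < a" for t
    using that by (subst integral_cong[of _ _ "\<lambda>_. 0"]) (auto intro: supp)
  have right: "integral {0..t} \<psi> = integral {0..b} \<psi>" if "b < t" for t
  proof -
    have "integral {0..t} \<psi> = integral {0..b} \<psi> + integral {b..t} \<psi>"
      using that ab int by (intro Henstock_Kurzweil_Integration.integral_combine[symmetric]) auto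
    also have "integral {b..t} \<psi> = integral {b..t} (\<lambda>_. 0)"
      by (rule integral_spike[of "{b}"]) (auto intro: supp)
    finally show ?thesis by simp
  qed
  have "((\<lambda>t. integral {0..t} \<psi>) has_real_derivative \<psi> t) (at t)" for t
  proof (cases "t < a")
    case True
    have "((\<lambda>t. integral {0..t} \<psi>) has_real_derivative 0) (at t)"
      by (rule has_field_derivative_transform_within_open[of "\<lambda>_. 0" _ _ "{..<a}"]) (use True left in auto)
    then show ?thesis using True supp[of t] by simp
  next
    case False
    have "((\<lambda>t. integral {0..t} \<psi>) has_real_derivative \<psi> t) (at t within {0..t+1})"
      by (rule integral_has_real_derivative) (use False ab continuous_on_subset[OF \<psi>] in auto)
    then show ?thesis using False ab by (subst (asm) at_within_Icc_at) auto
  qed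
  moreover have "closure {t. integral {0..t} \<psi> \<noteq> 0} \<subseteq> {a..b}"
  proof (rule closure_minimal)
    show "{t. integral {0..t} \<psi> \<noteq> 0} \<subseteq> {a..b}"
      using left right right[OF ab(3)] mean by (auto simp: not_less[symmetric])
  qed simp
  moreover from this have "compact (closure {t. integral {0..t} \<psi> \<noteq> 0})"
    by (metis bounded_closed_interval bounded_subset closed_closure compact_eq_bounded_closed)
  ultimately show ?thesis using \<psi> ab unfolding test_function_def by auto
qed

text \<open>A continuous function, supported in \<open>[a, b]\<close>, with slopes \<open>\<plusminus>n\<close> and cut off at height 1; it
  increases to the indicator function of \<open>(a, b)\<close> as \<open>n\<close> grows.\<close>

definition hat :: "real \<Rightarrow> real \<Rightarrow> nat \<Rightarrow> real \<Rightarrow> real" where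
  "hat a b n t = max 0 (min 1 (real n * min (t - a) (b - t)))"

lemma continuous_on_hat: "continuous_on S (hat a b n)"
  unfolding hat_def[abs_def] by (intro continuous_intros)

lemma hat_bounds: "0 \<le> hat a b n t" "hat a b n t \<le> 1"
  by (auto simp: hat_def)

lemma hat_outside: "t \<notin> {a..b} \<Longrightarrow> hat a b n t = 0"
proof -
  assume "t \<notin> {a..b}"
  then have "min (t - a) (b - t) \<le> 0" by auto
  then show ?thesis by (simp add: hat_def mult_nonneg_nonpos min.coboundedI2)
qed

lemma hat_tendsto: "(\<lambda>n. hat a b n t) \<longlonglongrightarrow> indicat_real {a<..<b} t"
proof (cases "t \<in> {a<..<b}")
  case True
  then have p: "min (t - a) (b - t) > 0" by auto
  obtain N where N: "real N * min (t - a) (b - t) \<ge> 1"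
    using reals_Archimedean3[OF p] by (meson less_imp_le)
  have "hat a b n t = 1" if "n \<ge> N" for n
  proof -
    have "real N * min (t - a) (b - t) \<le> real n * min (t - a) (b - t)"
      by (rule mult_right_mono) (use that p in auto)
    then show ?thesis using N by (simp add: hat_def)
  qed
  then show ?thesis using True by (auto intro!: tendsto_eventually eventually_sequentiallyI[of N])
next
  case False
  then have "min (t - a) (b - t) \<le> 0" by auto
  then have "hat a b n t = 0" for n
    by (simp add: hat_def mult_nonneg_nonpos min.coboundedI2)
  then show ?thesis using False by simp
qed

lemma integrable_bounded_times:
  fixes u :: "real \<Rightarrow> 'a::euclidean_space"
  assumes "integrable (lebesgue_on {0<..<T}) u" "continuous_on {0..T} \<eta>"
  shows "integrable (lebesgue_on {0<..<T}) (\<lambda>t. \<eta> t *\<^sub>R u t)"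
proof -
  have "compact (\<eta> ` {0..T})" using assms(2) by (rule compact_continuous_image) simp
  then have "bounded (\<eta> ` {0..T})" by (rule compact_imp_bounded)
  then obtain B where "\<forall>y\<in>\<eta> ` {0..T}. norm y \<le> B" unfolding bounded_iff ..
  then have B: "\<bar>\<eta> t\<bar> \<le> B" if "t \<in> {0..T}" for t using that by auto
  have [measurable]: "\<eta> \<in> borel_measurable (lebesgue_on {0<..<T})"
    by (rule continuous_imp_measurable_on_sets_lebesgue) (auto intro: continuous_on_subset[OF assms(2)])
  show ?thesis
  proof (rule Bochner_Integration.integrable_bound)
    show "integrable (lebesgue_on {0<..<T}) (\<lambda>t. B *\<^sub>R u t)" using assms by simp
    show "AE t in lebesgue_on {0<..<T}. norm (\<eta> t *\<^sub>R u t) \<le> norm (B *\<^sub>R u t)"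
    proof (rule AE_I2)
      fix t assume "t \<in> space (lebesgue_on {0<..<T})"
      then have "\<bar>\<eta> t\<bar> \<le> \<bar>B\<bar>" by (intro order_trans[OF B abs_ge_self]) auto
      then show "norm (\<eta> t *\<^sub>R u t) \<le> norm (B *\<^sub>R u t)" by (simp add: mult_right_mono)
    qed
  qed (use assms in measurable)
qed

lemma integrable_continuous_interval:
  fixes \<eta> :: "real \<Rightarrow> 'a::euclidean_space"
  assumes "continuous_on {0..T} \<eta>"
  shows "integrable (lebesgue_on {0<..<T}) \<eta>"
proof -
  have "\<eta> absolutely_integrable_on {0<..<T}"
    using absolutely_integrable_continuous_real[OF assms] by (simp add: absolutely_integrable_on_Icc_iff_Ioo)
  then show ?thesis by (simp add: set_integrable_def integrable_restrict_space)
qed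

text \<open>A continuous \<open>\<eta>\<close> with compact support becomes the derivative of a test function after a multiple of a
  fixed bump \<open>\<rho>\<close> is subtracted to remove the mean. Hence \<open>\<integral>\<eta> (u - c) = 0\<close> for the constant \<open>c\<close> that is
  the \<open>\<rho>\<close>-weighted mean of \<open>u\<close>. Letting \<open>\<eta>\<close> tend to the indicator functions of intervals gives \<open>u = c\<close>.\<close>

lemma du_Bois_Reymond:
  fixes u :: "real \<Rightarrow> 'a::euclidean_space"
  assumes T: "T > 0" and u: "integrable (lebesgue_on {0<..<T}) u"
    and test: "\<And>\<phi> \<phi>'. test_function T \<phi> \<phi>' \<Longrightarrow> (\<integral>t. \<phi>' t *\<^sub>R u t \<partial>lebesgue_on {0<..<T}) = 0"
  obtains c where "AE t in lebesgue_on {0<..<T}. u t = c"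
proof -
  let ?M = "lebesgue_on {0<..<T}"
  define \<rho> where "\<rho> = hat (T/3) (2*T/3) 1"
  define I where "I = integral {0..T} \<rho>"
  have c\<rho>: "continuous_on S \<rho>" for S by (simp add: \<rho>_def continuous_on_hat)
  have "I \<noteq> 0"
  proof
    assume "I = 0"
    then have "\<forall>t\<in>{0..T}. \<rho> t = 0"
      unfolding I_def by (subst (asm) integral_eq_0_iff) (use T hat_bounds c\<rho> in \<open>auto simp: \<rho>_def\<close>)
    then have "\<rho> (T/2) = 0" using T by auto
    then show False using T by (auto simp: \<rho>_def hat_def max_def min_def split: if_splits)
  qed
  define c where "c = (\<integral>t. \<rho> t *\<^sub>R u t \<partial>?M) /\<^sub>R I"
  interpret finite_measure ?M by (rule finite_measure_interval)
  have uc: "integrable ?M (\<lambda>t. u t - c)" using u by simp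
  have hat0: "(\<integral>t. hat a b n t *\<^sub>R (u t - c) \<partial>?M) = 0" if ab: "0 < a" "a < b" "b < T" for a b n
  proof -
    define J where "J = integral {0..T} (hat a b n)"
    define \<psi> where "\<psi> = (\<lambda>t. hat a b n t - (J / I) * \<rho> t)"
    have "test_function T (\<lambda>t. integral {0..t} \<psi>) \<psi>"
    proof (rule test_function_of_mean_zero[where a="min a (T/3)" and b="max b (2*T/3)"])
      show "continuous_on UNIV \<psi>" unfolding \<psi>_def by (intro continuous_intros continuous_on_hat c\<rho>)
      show "\<psi> t = 0" if "t \<notin> {min a (T/3)..max b (2*T/3)}" for t
        proof -
        have "t \<notin> {a..b}" "t \<notin> {T/3..2*T/3}" using that by auto
        then show ?thesis by (simp add: \<psi>_def \<rho>_def hat_outside del: atLeastAtMost_iff)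
      qed
      have "(hat a b n has_integral J) {0..T}" "(\<rho> has_integral I) {0..T}"
        unfolding J_def I_def
        by (intro integrable_integral integrable_continuous_real continuous_on_hat c\<rho>)+
      from integral_unique[OF has_integral_diff[OF this(1) has_integral_mult_right[OF this(2), of "J / I"]]]
      have "integral {0..T} \<psi> = J - (J / I) * I" unfolding \<psi>_def .
      then show "integral {0..T} \<psi> = 0" using \<open>I \<noteq> 0\<close> by simp
    qed (use T ab in auto)
    then have "(\<integral>t. \<psi> t *\<^sub>R u t \<partial>?M) = 0" by (rule test)
    moreover have iu: "integrable ?M (\<lambda>t. hat a b n t *\<^sub>R u t)" "integrable ?M (\<lambda>t. \<rho> t *\<^sub>R u t)"
      by (intro integrable_bounded_times u continuous_on_hat c\<rho>)+
    moreover have \<psi>_eq: "\<psi> t *\<^sub>R u t = hat a b n t *\<^sub>R u t - (J / I) *\<^sub>R (\<rho> t *\<^sub>R u t)" for t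
      by (simp add: \<psi>_def scaleR_left_diff_distrib)
    moreover have "(\<integral>t. hat a b n t *\<^sub>R u t - (J / I) *\<^sub>R (\<rho> t *\<^sub>R u t) \<partial>?M)
        = (\<integral>t. hat a b n t *\<^sub>R u t \<partial>?M) - (J / I) *\<^sub>R (\<integral>t. \<rho> t *\<^sub>R u t \<partial>?M)"
      by (subst Bochner_Integration.integral_diff)
        (intro iu integrable_scaleR_right | simp only: integral_scaleR_right)+
    ultimately have "(\<integral>t. hat a b n t *\<^sub>R u t \<partial>?M) = (J / I) *\<^sub>R (\<integral>t. \<rho> t *\<^sub>R u t \<partial>?M)"
      unfolding \<psi>_eq by (simp only: right_minus_eq)
    also have "\<dots> = J *\<^sub>R c" by (simp add: c_def divide_inverse)
    also have "J = (\<integral>t. hat a b n t \<partial>?M)"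
      unfolding J_def by (rule integral_interval_eq[symmetric]) (intro integrable_continuous_interval continuous_on_hat)
    finally show ?thesis
      using iu integrable_continuous_interval[OF continuous_on_hat] by (simp add: scaleR_right_diff_distrib)
  qed
  have "AE t in ?M. u t - c = 0"
  proof (rule AE_zero_if_interval_integrals_zero[OF uc])
    fix a b assume ab: "0 < a" "a < b" "b < T"
    have "(\<lambda>n. \<integral>t. hat a b n t *\<^sub>R (u t - c) \<partial>?M) \<longlonglongrightarrow> (\<integral>t. indicat_real {a<..<b} t *\<^sub>R (u t - c) \<partial>?M)"
    proof (rule integral_dominated_convergence[where w="\<lambda>t. norm (u t - c)"])
      show "AE t in ?M. (\<lambda>n. hat a b n t *\<^sub>R (u t - c)) \<longlonglongrightarrow> indicat_real {a<..<b} t *\<^sub>R (u t - c)"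
        by (rule AE_I2) (rule tendsto_scaleR[OF hat_tendsto tendsto_const])
      show "AE t in ?M. norm (hat a b n t *\<^sub>R (u t - c)) \<le> norm (u t - c)" for n
        by (intro AE_I2) (simp add: hat_bounds mult_left_le_one_le)
      show "(\<lambda>t. hat a b n t *\<^sub>R (u t - c)) \<in> borel_measurable ?M" for n
        by (rule borel_measurable_integrable[OF integrable_bounded_times[OF uc continuous_on_hat]])
      show "(\<lambda>t. indicat_real {a<..<b} t *\<^sub>R (u t - c)) \<in> borel_measurable ?M"
        using borel_measurable_integrable[OF uc] ab
        by (intro borel_measurable_scaleR borel_measurable_indicator) (auto simp: sets_restrict_space_iff)
    qed (use uc in auto)
    then have z: "(\<integral>t. indicat_real {a<..<b} t *\<^sub>R (u t - c) \<partial>?M) = 0"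
      using LIMSEQ_unique[OF _ tendsto_const] by (simp add: hat0[OF ab])
    have "integrable ?M (\<lambda>t. indicat_real {a<..<b} t *\<^sub>R (u t - c))"
      by (rule integrable_mult_indicator[OF _ uc]) (use ab in \<open>auto simp: sets_restrict_space_iff\<close>)
    then have "(\<integral>t. indicat_real {a<..<b} t *\<^sub>R (u t - c) \<partial>?M) = integral {0..T} (\<lambda>t. indicat_real {a<..<b} t *\<^sub>R (u t - c))"
      by (rule integral_interval_eq)
    also have "\<dots> = integral {0..T} (\<lambda>t. if t \<in> {a<..<b} then u t - c else 0)"
      by (rule integral_cong) (simp add: indicator_def)
    also have "\<dots> = integral ({0..T} \<inter> {a<..<b}) (\<lambda>t. u t - c)"
      using integral_restrict_Int[of "{0..T}" "{a<..<b}" "\<lambda>t. u t - c"] by (simp only: Int_commute)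
    also have "{0..T} \<inter> {a<..<b} = {a<..<b}" using ab by auto
    finally show "integral {a..b} (\<lambda>t. u t - c) = 0"
      using z by (simp add: integral_open_interval_real)
  qed
  then show thesis by (intro that[of c]) simp
qed

lemma AE_eq_continuous_imp_eq:
  fixes f g :: "real \<Rightarrow> 'a::euclidean_space"
  assumes T: "T > 0" and f: "continuous_on {0..T} f" and g: "continuous_on {0..T} g"
    and ae: "AE t in lebesgue_on {0<..<T}. f t = g t" and t: "t \<in> {0..T}"
  shows "f t = g t"
proof -
  define C where "C = {t \<in> {0..T}. f t = g t}"
  have "closed ({0..T} \<inter> (\<lambda>t. f t - g t) -` {0})"
    by (intro continuous_closed_preimage continuous_intros f g)
  also have "{0..T} \<inter> (\<lambda>t. f t - g t) -` {0} = C" by (auto simp: C_def)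
  finally have "closed C" .
  have "AE t\<in>{0<..<T} in lebesgue. t \<in> C"
    using ae by (auto simp: AE_restrict_space_iff C_def elim!: eventually_mono)
  then have "{0<..<T} \<subseteq> C" using mem_closed_if_AE_lebesgue_open[OF open_greaterThanLessThan \<open>closed C\<close>] by blast
  then have "closure {0<..<T} \<subseteq> C" by (rule closure_minimal) fact
  then show ?thesis using T t by (auto simp: C_def)
qed

text \<open>Picard iteration in the norm \<open>sup \<bar>e\<^bsup>-\<gamma>t\<^esup> x(t)\<bar>\<close>, which makes the integral operator a contraction on the
  whole interval at once. The weight is moved into the unknown, \<open>z(t) = e\<^bsup>-\<gamma>t\<^esup> x(t)\<close>, so that the
  contraction holds in the plain supremum norm on bounded continuous functions; functions on the
  interval are extended to the line by clamping the argument.\<close>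

lemma volterra:
  fixes L :: "'a::euclidean_space \<Rightarrow> 'a" and H :: "real \<Rightarrow> 'a"
  assumes T: "T > 0" and L: "bounded_linear L" and H: "continuous_on {0..T} H"
  obtains x where "continuous_on {0..T} x"
    "\<And>t. t \<in> {0..T} \<Longrightarrow> x t = H t + integral {0..t} (\<lambda>s. L (x s))"
proof -
  define K where "K = onorm L"
  have K: "K \<ge> 0" "\<And>v. norm (L v) \<le> K * norm v"
    using onorm_pos_le[OF L] onorm[OF L] by (simp_all add: K_def)
  \<comment> \<open>the contraction factor is \<open>K / \<gamma> \<le> 1/2\<close>\<close>
  define \<gamma> where "\<gamma> = 2 * K + 1"
  have \<gamma>: "\<gamma> > 0" using K by (simp add: \<gamma>_def)
  define \<Psi> where "\<Psi> z t = exp (- \<gamma> * t) *\<^sub>R (H t + integral {0..t} (\<lambda>s. exp (\<gamma> * s) *\<^sub>R L (z s)))" for z t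
  have cw: "continuous_on S (\<lambda>s. exp (\<gamma> * s) *\<^sub>R L (apply_bcontfun z s))" for S and z :: "real \<Rightarrow>\<^sub>C 'a"
    by (intro continuous_intros bounded_linear.continuous_on[OF L] continuous_on_apply_bcontfun)
  have iw: "(\<lambda>s. exp (\<gamma> * s) *\<^sub>R L (apply_bcontfun z s)) integrable_on {0..t}" for t and z :: "real \<Rightarrow>\<^sub>C 'a"
    by (rule integrable_continuous_real[OF cw])
  have "\<exists>h. \<forall>t. apply_bcontfun h t = \<Psi> (apply_bcontfun z) (clamp 0 T t)" for z :: "real \<Rightarrow>\<^sub>C 'a"
  proof -
    have "continuous_on {0..T} (\<Psi> z)"
      unfolding \<Psi>_def by (intro continuous_intros H indefinite_integral_continuous_1 iw)
    then show ?thesis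
      by (metis continuous_on_cbox_bcontfunE interval_cbox)
  qed
  then obtain P where P: "\<And>z t. apply_bcontfun (P z) t = \<Psi> (apply_bcontfun z) (clamp 0 T t)" by metis
  have cl: "clamp 0 T t \<in> {0..T}" for t using clamp_in_interval[of 0 T t] T by simp
  have lip: "dist (P z) (P w) \<le> 1/2 * dist z w" for z w
  proof (rule dist_bound)
    fix r
    define t where "t = clamp 0 T r"
    have t: "0 \<le> t" using cl[of r] by (simp add: t_def)
    define d where "d = dist z w"
    have d: "norm (apply_bcontfun z s - apply_bcontfun w s) \<le> d" for s
      using dist_bounded[of z s w] by (simp add: d_def dist_norm)
    have ex: "((\<lambda>s. exp (\<gamma> * s)) has_integral (exp (\<gamma> * t) / \<gamma> - exp (\<gamma> * 0) / \<gamma>)) {0..t}"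
      by (rule fundamental_theorem_of_calculus)
         (use t \<gamma> in \<open>auto intro!: derivative_eq_intros simp: has_real_derivative_iff_has_vector_derivative[symmetric]\<close>)
    have "norm (integral {0..t} (\<lambda>s. exp (\<gamma> * s) *\<^sub>R L (z s)) - integral {0..t} (\<lambda>s. exp (\<gamma> * s) *\<^sub>R L (w s)))
        = norm (integral {0..t} (\<lambda>s. exp (\<gamma> * s) *\<^sub>R L (z s - w s)))"
      by (subst Henstock_Kurzweil_Integration.integral_diff[OF iw iw, symmetric])
         (simp add: linear_diff[OF bounded_linear.linear[OF L]] scaleR_right_diff_distrib)
    also have "\<dots> \<le> integral {0..t} (\<lambda>s. exp (\<gamma> * s) * (K * d))"
    proof (rule integral_norm_bound_integral)
      show "(\<lambda>s. exp (\<gamma> * s) *\<^sub>R L (z s - w s)) integrable_on {0..t}"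
        by (intro integrable_continuous_real continuous_intros bounded_linear.continuous_on[OF L] continuous_on_apply_bcontfun)
      show "(\<lambda>s. exp (\<gamma> * s) * (K * d)) integrable_on {0..t}"
        by (intro integrable_continuous_real continuous_intros)
      show "norm (exp (\<gamma> * s) *\<^sub>R L (z s - w s)) \<le> exp (\<gamma> * s) * (K * d)" for s
        using order_trans[OF K(2) mult_left_mono[OF d K(1)]] by simp
    qed
    also have "\<dots> = (exp (\<gamma> * t) / \<gamma> - 1 / \<gamma>) * (K * d)"
      using has_integral_mult_left[OF ex, of "K * d"] by (intro integral_unique) simp
    also have "\<dots> \<le> (exp (\<gamma> * t) / \<gamma>) * (K * d)"
      using \<gamma> K order_trans[OF norm_ge_zero d] by (intro mult_right_mono) auto
    finally have "norm (integral {0..t} (\<lambda>s. exp (\<gamma> * s) *\<^sub>R L (z s)) - integral {0..t} (\<lambda>s. exp (\<gamma> * s) *\<^sub>R L (w s)))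
      \<le> exp (\<gamma> * t) * (K * d / \<gamma>)" by simp
    from mult_left_mono[OF this, of "exp (- \<gamma> * t)"] have "exp (- \<gamma> * t) *
        norm (integral {0..t} (\<lambda>s. exp (\<gamma> * s) *\<^sub>R L (z s)) - integral {0..t} (\<lambda>s. exp (\<gamma> * s) *\<^sub>R L (w s)))
      \<le> exp (- \<gamma> * t) * (exp (\<gamma> * t) * (K * d / \<gamma>))" by (simp only: exp_ge_zero)
    moreover have "dist (P z r) (P w r) = exp (- \<gamma> * t) *
        norm (integral {0..t} (\<lambda>s. exp (\<gamma> * s) *\<^sub>R L (z s)) - integral {0..t} (\<lambda>s. exp (\<gamma> * s) *\<^sub>R L (w s)))"
      by (simp add: P \<Psi>_def t_def[symmetric] dist_norm scaleR_right_diff_distrib[symmetric])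
    ultimately have "dist (P z r) (P w r) \<le> exp (- \<gamma> * t) * (exp (\<gamma> * t) * (K * d / \<gamma>))"
      by (simp only:)
    also have "\<dots> = K / \<gamma> * d" by (simp add: mult.assoc[symmetric] exp_add[symmetric])
    also have "\<dots> \<le> 1/2 * d"
      using K \<gamma> order_trans[OF norm_ge_zero d] by (intro mult_right_mono) (auto simp: \<gamma>_def field_simps)
    finally show "dist (P z r) (P w r) \<le> 1/2 * dist z w" by (simp add: d_def)
  qed
  then obtain z where z: "P z = z"
    using banach_fix_type[of "1/2" P] by auto
  show thesis
  proof (rule that[of "\<lambda>t. exp (\<gamma> * t) *\<^sub>R apply_bcontfun z t"])
    show "continuous_on {0..T} (\<lambda>t. exp (\<gamma> * t) *\<^sub>R z t)"
      by (intro continuous_intros continuous_on_apply_bcontfun)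
    fix t assume t: "t \<in> {0..T}"
    then have "z t = \<Psi> z t" using P[of z t] T by (simp add: z)
    then show "exp (\<gamma> * t) *\<^sub>R z t = H t + integral {0..t} (\<lambda>s. L (exp (\<gamma> * s) *\<^sub>R z s))"
      by (simp add: \<Psi>_def exp_add[symmetric] linear_cmul[OF bounded_linear.linear[OF L]])
  qed
qed

section \<open>Calculation with classes of square integrable functions\<close>

lemma sq_integrableD:
  assumes "f \<in> sq_integrable T"
  shows "f \<in> borel_measurable (lebesgue_on {0<..<T})"
    and "integrable (lebesgue_on {0<..<T}) (\<lambda>t. (norm (f t))\<^sup>2)"
  using assms by (auto simp: sq_integrable_def)

lemma sq_integrable_bound:
  fixes f :: "real \<Rightarrow> 'a::euclidean_space"
  assumes f: "f \<in> borel_measurable (lebesgue_on {0<..<T})"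
    and w: "integrable (lebesgue_on {0<..<T}) w"
    and le: "\<And>t. t \<in> {0<..<T} \<Longrightarrow> (norm (f t))\<^sup>2 \<le> w t"
  shows "f \<in> sq_integrable T"
proof -
  have "integrable (lebesgue_on {0<..<T}) (\<lambda>t. (norm (f t))\<^sup>2)"
    by (rule Bochner_Integration.integrable_bound[OF w])
       (use f in measurable, use le in \<open>auto intro!: AE_I2 order_trans[OF _ abs_ge_self]\<close>)
  then show ?thesis using f by (simp add: sq_integrable_def)
qed

lemma sq_integrable_imp_integrable:
  assumes "f \<in> sq_integrable T"
  shows "integrable (lebesgue_on {0<..<T}) f"
proof -
  interpret finite_measure "lebesgue_on {0<..<T}" by (rule finite_measure_interval)
  show ?thesis
  proof (rule Bochner_Integration.integrable_bound)
    show "integrable (lebesgue_on {0<..<T}) (\<lambda>t. 1 + (norm (f t))\<^sup>2)"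
      using sq_integrableD(2)[OF assms] by simp
    have "x \<le> 1 + x\<^sup>2" for x :: real
      using zero_le_power2[of x] zero_le_power2[of "x - 1"]
      unfolding power2_diff one_power2 mult_1_right by linarith
    then show "AE t in lebesgue_on {0<..<T}. norm (f t) \<le> norm (1 + (norm (f t))\<^sup>2)"
      by (intro AE_I2) simp
  qed (use sq_integrableD(1)[OF assms] in measurable)
qed

lemma norm_add_sq_le: "(norm (x + y))\<^sup>2 \<le> 2 * (norm x)\<^sup>2 + 2 * (norm y)\<^sup>2"
  for x y :: "'a::real_normed_vector"
proof -
  have "(norm (x + y))\<^sup>2 \<le> (norm x + norm y)\<^sup>2"
    by (rule power_mono[OF norm_triangle_ineq norm_ge_zero])
  also have "\<dots> \<le> 2 * (norm x)\<^sup>2 + 2 * (norm y)\<^sup>2"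
    using sum_squares_bound[of "norm x" "norm y"] by (simp add: power2_sum)
  finally show ?thesis .
qed

lemma sq_integrable_add:
  assumes "f \<in> sq_integrable T" "g \<in> sq_integrable T"
  shows "(\<lambda>t. f t + g t) \<in> sq_integrable T"
  by (rule sq_integrable_bound[of _ _ "\<lambda>t. 2 * (norm (f t))\<^sup>2 + 2 * (norm (g t))\<^sup>2"])
     (use assms[THEN sq_integrableD(1)] assms[THEN sq_integrableD(2)] norm_add_sq_le in auto)

lemma sq_integrable_linear:
  fixes f :: "real \<Rightarrow> 'a::euclidean_space" and L :: "'a \<Rightarrow> 'b::euclidean_space"
  assumes f: "f \<in> sq_integrable T" and L: "bounded_linear L"
  shows "(\<lambda>t. L (f t)) \<in> sq_integrable T"
proof (rule sq_integrable_bound[of _ _ "\<lambda>t. (onorm L)\<^sup>2 * (norm (f t))\<^sup>2"])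
  show "(\<lambda>t. L (f t)) \<in> borel_measurable (lebesgue_on {0<..<T})"
    by (rule borel_measurable_continuous_on[OF linear_continuous_on[OF L] sq_integrableD(1)[OF f]])
  show "(norm (L (f t)))\<^sup>2 \<le> (onorm L)\<^sup>2 * (norm (f t))\<^sup>2" for t
    using power_mono[OF onorm[OF L] norm_ge_zero, of "f t" 2] by (simp add: power_mult_distrib)
qed (use sq_integrableD(2)[OF f] in simp)

lemma sq_integrable_scaleR: "f \<in> sq_integrable T \<Longrightarrow> (\<lambda>t. a *\<^sub>R f t) \<in> sq_integrable T"
  using sq_integrable_linear[OF _ bounded_linear_scaleR_right] .

lemma sq_integrable_diff:
  "f \<in> sq_integrable T \<Longrightarrow> g \<in> sq_integrable T \<Longrightarrow> (\<lambda>t. f t - g t) \<in> sq_integrable T"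
  using sq_integrable_add[OF _ sq_integrable_scaleR[of g T "-1"], of f] by simp

lemma sq_integrable_matrix:
  fixes M :: "real^'n^'m"
  shows "f \<in> sq_integrable T \<Longrightarrow> (\<lambda>t. M *v f t) \<in> sq_integrable T"
  by (rule sq_integrable_linear[OF _ matrix_vector_mul_bounded_linear])

lemma sq_integrable_continuous:
  assumes "continuous_on {0..T} f"
  shows "f \<in> sq_integrable T"
proof -
  have "continuous_on {0..T} (\<lambda>t. (norm (f t))\<^sup>2)" by (intro continuous_intros assms)
  then show ?thesis
    using integrable_continuous_interval[OF assms] integrable_continuous_interval[of T "\<lambda>t. (norm (f t))\<^sup>2"]
    by (simp add: sq_integrable_def)
qed

lemma equiv_ae_eq: "equiv (sq_integrable T) (ae_eq T)"
proof (rule equivI)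
  show "ae_eq T \<subseteq> sq_integrable T \<times> sq_integrable T" by (auto simp: ae_eq_def)
  show "refl_on (sq_integrable T) (ae_eq T)" by (auto simp: refl_on_def ae_eq_def)
  show "sym (ae_eq T)" by (auto simp: sym_def ae_eq_def elim: eventually_mono)
  show "trans (ae_eq T)" by (auto simp: trans_def ae_eq_def elim: eventually_elim2)
qed

lemma cls_in_L2: "f \<in> sq_integrable T \<Longrightarrow> cls T f \<in> vs_carrier (L2 T)"
  by (simp add: L2_def cls_def quotientI)

lemma L2_cases:
  assumes "X \<in> vs_carrier (L2 T)"
  obtains f where "f \<in> sq_integrable T" "X = cls T f"
  using assms unfolding L2_def cls_def by (auto elim: quotientE)

lemma cls_eq_iff:
  "f \<in> sq_integrable T \<Longrightarrow> g \<in> sq_integrable T \<Longrightarrow>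
    cls T f = cls T g \<longleftrightarrow> (AE t in lebesgue_on {0<..<T}. f t = g t)"
  unfolding cls_def by (subst eq_equiv_class_iff[OF equiv_ae_eq]) (auto simp: ae_eq_def)

lemma cls_eqI:
  assumes "f \<in> sq_integrable T" "g \<in> sq_integrable T" "\<And>t. t \<in> {0<..<T} \<Longrightarrow> f t = g t"
  shows "cls T f = cls T g"
  using assms by (subst cls_eq_iff) auto

lemma
  assumes f: "f \<in> sq_integrable T"
  shows rep_cls_sq_integrable: "rep (cls T f) \<in> sq_integrable T"
    and rep_cls_AE: "AE t in lebesgue_on {0<..<T}. rep (cls T f) t = f t"
proof -
  have "f \<in> cls T f" unfolding cls_def by (rule equiv_class_self[OF equiv_ae_eq f])
  then have "rep (cls T f) \<in> cls T f" unfolding rep_def by (rule someI[where P="\<lambda>h. h \<in> cls T f"])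
  then show "rep (cls T f) \<in> sq_integrable T" "AE t in lebesgue_on {0<..<T}. rep (cls T f) t = f t"
    by (auto simp: cls_def ae_eq_def elim: eventually_mono)
qed

text \<open>The operations are defined through chosen representatives; the following equations replace these by
  any representative.\<close>

lemma L2_add_cls:
  assumes "f \<in> sq_integrable T" "g \<in> sq_integrable T"
  shows "vs_add (L2 T) (cls T f) (cls T g) = cls T (\<lambda>t. f t + g t)"
  using rep_cls_AE[OF assms(1)] rep_cls_AE[OF assms(2)]
  by (simp add: L2_def)
     (subst cls_eq_iff, auto intro!: sq_integrable_add rep_cls_sq_integrable assms elim: eventually_elim2)

lemma L2_scale_cls:
  assumes "f \<in> sq_integrable T"
  shows "vs_scale (L2 T) a (cls T f) = cls T (\<lambda>t. a *\<^sub>R f t)"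
  using rep_cls_AE[OF assms]
  by (simp add: L2_def)
     (subst cls_eq_iff, auto intro!: sq_integrable_scaleR rep_cls_sq_integrable assms elim: eventually_mono)

lemma L2_diff_cls:
  assumes "f \<in> sq_integrable T" "g \<in> sq_integrable T"
  shows "vs_diff (L2 T) (cls T f) (cls T g) = cls T (\<lambda>t. f t - g t)"
  using assms by (simp add: vs_diff_def L2_scale_cls L2_add_cls sq_integrable_scaleR sq_integrable_linear[OF _ bounded_linear_minus[OF bounded_linear_ident]])

lemma matrix_op_cls:
  assumes "f \<in> sq_integrable T"
  shows "matrix_op T M (cls T f) = cls T (\<lambda>t. M *v f t)"
  using rep_cls_AE[OF assms] unfolding matrix_op_def
  by (subst cls_eq_iff) (auto intro!: sq_integrable_matrix rep_cls_sq_integrable assms elim: eventually_mono)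

definition sq_norm :: "real \<Rightarrow> (real \<Rightarrow> 'a::euclidean_space) \<Rightarrow> real" where
  "sq_norm T f = (\<integral>t. (norm (f t))\<^sup>2 \<partial>lebesgue_on {0<..<T})"

lemma sq_norm_nonneg [simp]: "0 \<le> sq_norm T f"
  unfolding sq_norm_def by simp

lemma sq_norm_cong_AE:
  assumes "f \<in> sq_integrable T" "g \<in> sq_integrable T" "AE t in lebesgue_on {0<..<T}. f t = g t"
  shows "sq_norm T f = sq_norm T g"
  unfolding sq_norm_def
  by (rule integral_cong_AE) (use assms sq_integrableD(2) in \<open>auto elim: eventually_mono\<close>)

lemma L2_norm_cls:
  assumes "f \<in> sq_integrable T"
  shows "vs_norm (L2 T) (cls T f) = sqrt (sq_norm T f)"
  using sq_norm_cong_AE[OF rep_cls_sq_integrable[OF assms] assms rep_cls_AE[OF assms]]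
  by (simp add: L2_def sq_norm_def)

section \<open>Sobolev functions as indefinite integrals\<close>

lemma is_weak_deriv_cls_iff:
  assumes f: "f \<in> sq_integrable T" and g: "g \<in> sq_integrable T"
  shows "is_weak_deriv T (cls T f) (cls T g) \<longleftrightarrow> (\<forall>\<phi> \<phi>'. test_function T \<phi> \<phi>' \<longrightarrow>
    (\<integral>t. \<phi>' t *\<^sub>R f t \<partial>lebesgue_on {0<..<T}) = - (\<integral>t. \<phi> t *\<^sub>R g t \<partial>lebesgue_on {0<..<T}))"
proof -
  have eq: "(\<integral>t. \<eta> t *\<^sub>R rep (cls T h) t \<partial>lebesgue_on {0<..<T}) = (\<integral>t. \<eta> t *\<^sub>R h t \<partial>lebesgue_on {0<..<T})"
    if h: "h \<in> sq_integrable T" and \<eta>: "continuous_on UNIV \<eta>" for \<eta> :: "real \<Rightarrow> real" and h :: "real \<Rightarrow> 'a"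
  proof (rule integral_cong_AE)
    show "AE t in lebesgue_on {0<..<T}. \<eta> t *\<^sub>R rep (cls T h) t = \<eta> t *\<^sub>R h t"
      using rep_cls_AE[OF h] by (auto elim: eventually_mono)
  qed (intro borel_measurable_integrable integrable_bounded_times sq_integrable_imp_integrable
      rep_cls_sq_integrable h continuous_on_subset[OF \<eta>] subset_UNIV)+
  have "continuous_on UNIV \<phi>'" "continuous_on UNIV \<phi>" if "test_function T \<phi> \<phi>'" for \<phi> \<phi>'
    using that unfolding test_function_def by (blast intro: DERIV_continuous_on has_field_derivative_at_within)+
  then show ?thesis unfolding is_weak_deriv_def using eq[OF f] eq[OF g] by (metis (no_types, lifting))
qed

lemma test_function_eq_primitive:
  assumes "test_function T \<phi> \<phi>'"
  shows "integrable (lebesgue_on {0<..<T}) \<phi>'" "\<And>t. 0 \<le> t \<Longrightarrow> primitive 0 \<phi>' t = \<phi> t" "\<phi> T = 0"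
proof -
  have *: "\<And>t. (\<phi> has_real_derivative \<phi>' t) (at t)" "continuous_on UNIV \<phi>'"
    "closure {t. \<phi> t \<noteq> 0} \<subseteq> {0<..<T}"
    using assms by (auto simp: test_function_def)
  show "integrable (lebesgue_on {0<..<T}) \<phi>'"
    by (rule integrable_continuous_interval) (rule continuous_on_subset[OF *(2)], simp)
  have z: "\<phi> t = 0" if "t \<notin> {0<..<T}" for t using *(3) closure_subset[of "{t. \<phi> t \<noteq> 0}"] that by blast
  then show "\<phi> T = 0" by simp
  show "primitive 0 \<phi>' t = \<phi> t" if "0 \<le> t" for t
  proof -
    have "(\<phi>' has_integral (\<phi> t - \<phi> 0)) {0..t}"
      by (rule fundamental_theorem_of_calculus[OF that])
         (use *(1) in \<open>auto simp: has_real_derivative_iff_has_vector_derivative[symmetric] intro: has_field_derivative_at_within\<close>)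
    then show ?thesis using z[of 0] by (simp add: primitive_def integral_unique)
  qed
qed

lemma sq_integrable_primitive:
  "g \<in> sq_integrable T \<Longrightarrow> primitive c g \<in> sq_integrable T"
  by (rule sq_integrable_continuous[OF continuous_on_primitive[OF sq_integrable_imp_integrable]])

text \<open>Integration by parts; the boundary terms vanish because a test function vanishes at \<open>0\<close> and \<open>T\<close>.\<close>

lemma is_weak_deriv_primitive:
  assumes g: "g \<in> sq_integrable T" and T: "T > 0"
  shows "is_weak_deriv T (cls T (primitive c g)) (cls T g)"
  unfolding is_weak_deriv_cls_iff[OF sq_integrable_primitive[OF g] g]
proof (intro allI impI)
  fix \<phi> \<phi>' assume t: "test_function T \<phi> \<phi>'"
  note p = test_function_eq_primitive[OF t]
  have "primitive 0 \<phi>' T *\<^sub>R primitive c g T - 0 *\<^sub>R c =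
    (\<integral>t. primitive 0 \<phi>' t *\<^sub>R g t \<partial>lebesgue_on {0<..<T})
      + (\<integral>t. \<phi>' t *\<^sub>R primitive c g t \<partial>lebesgue_on {0<..<T})"
    by (rule integral_by_parts_primitive(3)[OF bounded_bilinear_scaleR p(1) sq_integrable_imp_integrable[OF g]])
  also have "(\<integral>t. primitive 0 \<phi>' t *\<^sub>R g t \<partial>lebesgue_on {0<..<T}) = (\<integral>t. \<phi> t *\<^sub>R g t \<partial>lebesgue_on {0<..<T})"
    by (rule Bochner_Integration.integral_cong) (auto simp: p(2))
  finally show "(\<integral>t. \<phi>' t *\<^sub>R primitive c g t \<partial>lebesgue_on {0<..<T}) = - (\<integral>t. \<phi> t *\<^sub>R g t \<partial>lebesgue_on {0<..<T})"
    using T p(2)[of T] p(3) by (simp add: eq_neg_iff_add_eq_0 add.commute)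
qed

text \<open>The difference of \<open>f\<close> and the indefinite integral of \<open>g\<close> has weak derivative zero, so it is constant.\<close>

lemma weak_deriv_imp_primitive:
  assumes T: "T > 0" and f: "f \<in> sq_integrable T" and g: "g \<in> sq_integrable T"
    and w: "is_weak_deriv T (cls T f) (cls T g)"
  obtains c where "cls T f = cls T (primitive c g)"
proof -
  note p = sq_integrable_primitive[OF g, of 0]
  have "integrable (lebesgue_on {0<..<T}) (\<lambda>t. f t - primitive 0 g t)"
    by (rule sq_integrable_imp_integrable[OF sq_integrable_diff[OF f p]])
  moreover have "(\<integral>t. \<phi>' t *\<^sub>R (f t - primitive 0 g t) \<partial>lebesgue_on {0<..<T}) = 0"
    if t: "test_function T \<phi> \<phi>'" for \<phi> \<phi>'
  proof -
    have c: "continuous_on {0..T} \<phi>'"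
      using t continuous_on_subset unfolding test_function_def by blast
    have "integrable (lebesgue_on {0<..<T}) (\<lambda>t. \<phi>' t *\<^sub>R f t)" "integrable (lebesgue_on {0<..<T}) (\<lambda>t. \<phi>' t *\<^sub>R primitive 0 g t)"
      by (rule integrable_bounded_times[OF _ c], rule sq_integrable_imp_integrable, fact)+
    then show ?thesis
      using w[unfolded is_weak_deriv_cls_iff[OF f g], rule_format, OF t]
        is_weak_deriv_primitive[OF g T, of 0, unfolded is_weak_deriv_cls_iff[OF p g], rule_format, OF t]
      by (simp add: scaleR_right_diff_distrib)
  qed
  ultimately obtain c where c: "AE t in lebesgue_on {0<..<T}. f t - primitive 0 g t = c"
    using du_Bois_Reymond[OF T] by blast
  have "AE t in lebesgue_on {0<..<T}. f t = primitive c g t"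
    using c by (rule eventually_mono) (auto simp: primitive_def)
  then have "cls T f = cls T (primitive c g)"
    by (simp add: cls_eq_iff f sq_integrable_primitive[OF g])
  then show thesis by (rule that)
qed

text \<open>Two continuous representatives agree everywhere on the closed interval; at \<open>0\<close> this compares the
  constants, and the increments over intervals determine the integrands.\<close>

lemma primitive_class_inject:
  assumes T: "T > 0" and g: "g \<in> sq_integrable T" and h: "h \<in> sq_integrable T"
    and eq: "cls T (primitive c g) = cls T (primitive d h)"
  shows "c = d" "cls T g = cls T h"
proof -
  note gi = sq_integrable_imp_integrable[OF g] and hi = sq_integrable_imp_integrable[OF h]
  have e: "primitive c g t = primitive d h t" if "t \<in> {0..T}" for t
    by (rule AE_eq_continuous_imp_eq[OF T continuous_on_primitive[OF gi] continuous_on_primitive[OF hi] _ that])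
       (use eq in \<open>simp add: cls_eq_iff sq_integrable_primitive g h\<close>)
  from e[of 0] T show "c = d" by simp
  have "AE t in lebesgue_on {0<..<T}. g t - h t = 0"
  proof (rule AE_zero_if_interval_integrals_zero)
    show "integrable (lebesgue_on {0<..<T}) (\<lambda>t. g t - h t)" using gi hi by simp
    fix a b assume ab: "0 < a" "a < b" "b < T"
    have pre: "integral {0..t} (\<lambda>t. g t - h t) = 0" "(\<lambda>t. g t - h t) integrable_on {0..t}" if "0 \<le> t" "t \<le> T" for t
      using e[of t] that integrable_on_prefix[OF gi, of t] integrable_on_prefix[OF hi, of t] \<open>c = d\<close>
      by (simp_all add: primitive_def Henstock_Kurzweil_Integration.integral_diff Henstock_Kurzweil_Integration.integrable_diff)
    have "integral {0..a} (\<lambda>t. g t - h t) + integral {a..b} (\<lambda>t. g t - h t) = integral {0..b} (\<lambda>t. g t - h t)"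
      by (rule Henstock_Kurzweil_Integration.integral_combine) (use ab pre in auto)
    then show "integral {a..b} (\<lambda>t. g t - h t) = 0" using pre ab by simp
  qed
  then show "cls T g = cls T h" using g h by (simp add: cls_eq_iff)
qed

text \<open>Together with \<open>initial_value_primitive\<close> and \<open>H1_cases\<close> this makes \<open>(g, c)\<close> a system of coordinates on
  the Sobolev space in which the weak derivative and the initial value are the two projections.\<close>

lemma weak_deriv_primitive:
  assumes T: "T > 0" and g: "g \<in> sq_integrable T"
  shows "weak_deriv T (cls T (primitive c g)) = cls T g"
  unfolding weak_deriv_def
proof (rule the_equality)
  fix G assume G: "G \<in> vs_carrier (L2 T) \<and> is_weak_deriv T (cls T (primitive c g)) G"
  then obtain h where h: "h \<in> sq_integrable T" "G = cls T h" by (meson L2_cases)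
  obtain d where "cls T (primitive c g) = cls T (primitive d h)"
    by (rule weak_deriv_imp_primitive[OF T sq_integrable_primitive[OF g] h(1)]) (use G h in auto)
  from primitive_class_inject(2)[OF T g h(1) this] show "G = cls T g" using h by simp
qed (use g T in \<open>simp add: cls_in_L2 is_weak_deriv_primitive\<close>)

lemma initial_value_primitive:
  assumes T: "T > 0" and g: "g \<in> sq_integrable T"
  shows "initial_value T (cls T (primitive c g)) = c"
  unfolding initial_value_def
proof (rule the_equality)
  let ?p = "primitive c g"
  note p = sq_integrable_primitive[OF g, of c]
  have cont: "continuous_on {0..T} ?p"
    by (rule continuous_on_primitive[OF sq_integrable_imp_integrable[OF g]])
  have "?p \<in> cls T ?p" unfolding cls_def by (rule equiv_class_self[OF equiv_ae_eq p])
  then show "\<exists>f\<in>cls T ?p. continuous_on {0..T} f \<and> f 0 = c"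
    using cont by (intro bexI[of _ ?p]) auto
  fix v assume "\<exists>f\<in>cls T ?p. continuous_on {0..T} f \<and> f 0 = v"
  then obtain f where f: "f \<in> cls T ?p" "continuous_on {0..T} f" "f 0 = v" by blast
  have "AE t in lebesgue_on {0<..<T}. ?p t = f t" using f(1) by (simp add: cls_def ae_eq_def)
  from AE_eq_continuous_imp_eq[OF T cont f(2) this, of 0] T f(3) show "v = c" by simp
qed

lemma primitive_in_H1:
  "T > 0 \<Longrightarrow> g \<in> sq_integrable T \<Longrightarrow> cls T (primitive c g) \<in> vs_carrier (H1 T)"
  using is_weak_deriv_primitive[of g T c] by (auto simp: H1_def cls_in_L2 sq_integrable_primitive)

lemma H1_cases:
  assumes "T > 0" "X \<in> vs_carrier (H1 T)"
  obtains c g where "g \<in> sq_integrable T" "X = cls T (primitive c g)"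
proof -
  obtain G where X: "X \<in> vs_carrier (L2 T)" and G: "G \<in> vs_carrier (L2 T)" "is_weak_deriv T X G"
    using assms(2) by (auto simp: H1_def)
  obtain f where f: "f \<in> sq_integrable T" "X = cls T f" using X by (rule L2_cases)
  obtain g where g: "g \<in> sq_integrable T" "G = cls T g" using G(1) by (rule L2_cases)
  show thesis
    by (rule weak_deriv_imp_primitive[OF assms(1) f(1) g(1)]) (use G f g that in auto)
qed

lemma H1_norm_primitive:
  assumes "T > 0" "g \<in> sq_integrable T"
  shows "vs_norm (H1 T) (cls T (primitive c g)) = sqrt (sq_norm T (primitive c g) + sq_norm T g)"
  by (simp add: H1_def weak_deriv_primitive assms L2_norm_cls sq_integrable_primitive)

lemma primitive_add:
  assumes "g \<in> sq_integrable T" "h \<in> sq_integrable T" "t \<in> {0<..<T}"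
  shows "primitive c g t + primitive d h t = primitive (c + d) (\<lambda>t. g t + h t) t"
  using integrable_on_prefix[OF sq_integrable_imp_integrable[OF assms(1)], of t]
    integrable_on_prefix[OF sq_integrable_imp_integrable[OF assms(2)], of t] assms(3)
  by (simp add: primitive_def Henstock_Kurzweil_Integration.integral_add)

lemma primitive_scaleR: "a *\<^sub>R primitive c g t = primitive (a *\<^sub>R c) (\<lambda>t. a *\<^sub>R g t) t"
  by (simp add: primitive_def scaleR_add_right)

lemma H1_add_primitive:
  assumes "g \<in> sq_integrable T" "h \<in> sq_integrable T"
  shows "vs_add (H1 T) (cls T (primitive c g)) (cls T (primitive d h))
    = cls T (primitive (c + d) (\<lambda>t. g t + h t))"
proof -
  have "vs_add (H1 T) (cls T (primitive c g)) (cls T (primitive d h))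
    = cls T (\<lambda>t. primitive c g t + primitive d h t)"
    using assms by (simp add: H1_def L2_add_cls sq_integrable_primitive)
  also have "\<dots> = cls T (primitive (c + d) (\<lambda>t. g t + h t))"
    by (rule cls_eqI[OF sq_integrable_add sq_integrable_primitive])
       (use assms in \<open>auto intro: sq_integrable_add sq_integrable_primitive primitive_add\<close>)
  finally show ?thesis .
qed

lemma H1_scale_primitive:
  assumes "g \<in> sq_integrable T"
  shows "vs_scale (H1 T) a (cls T (primitive c g)) = cls T (primitive (a *\<^sub>R c) (\<lambda>t. a *\<^sub>R g t))"
  using assms by (simp add: H1_def L2_scale_cls sq_integrable_primitive primitive_scaleR[abs_def])

section \<open>Estimates\<close>

text \<open>Cauchy--Schwarz against the constant function, from the nonnegativity of a variance.\<close>

lemma integral_norm_square_le: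
  assumes T: "T > 0" and g: "g \<in> sq_integrable T"
  shows "(\<integral>t. norm (g t) \<partial>lebesgue_on {0<..<T})\<^sup>2 \<le> T * sq_norm T g"
proof -
  let ?M = "lebesgue_on {0<..<T}"
  interpret finite_measure ?M by (rule finite_measure_interval)
  have m: "measure ?M (space ?M) = T"
    using T by (simp add: measure_restrict_space)
  define I where "I = (\<integral>t. norm (g t) \<partial>?M)"
  have i1: "integrable ?M (\<lambda>t. norm (g t))"
    using sq_integrable_imp_integrable[OF g] by simp
  note i2 = sq_integrableD(2)[OF g]
  have "0 \<le> (\<integral>t. (norm (g t) - I / T)\<^sup>2 \<partial>?M)" by simp
  also have "\<dots> = (\<integral>t. (norm (g t))\<^sup>2 - 2 * (I / T) * norm (g t) + (I / T)\<^sup>2 \<partial>?M)"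
    by (simp add: power2_diff algebra_simps)
  also have "\<dots> = sq_norm T g - 2 * (I / T) * I + (I / T)\<^sup>2 * T"
    using i1 i2 m by (simp add: sq_norm_def I_def)
  also have "\<dots> = sq_norm T g - I\<^sup>2 / T"
    using T by (simp add: power2_eq_square field_simps)
  finally show ?thesis using T by (simp add: I_def[symmetric] field_simps)
qed

text \<open>Square and average \<open>x(0) = x(t) - \<integral>\<^sub>0\<^sup>t x'\<close> over \<open>t\<close>. The constant blows up as \<open>T\<close> tends to \<open>0\<close> or to infinity, which
  is harmless because only the inverse has to be bounded uniformly.\<close>

lemma initial_value_bound:
  assumes T: "T > 0" and g: "g \<in> sq_integrable T"
  shows "(norm c)\<^sup>2 \<le> (2 / T + 2 * T) * (sq_norm T (primitive c g) + sq_norm T g)"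
proof -
  let ?M = "lebesgue_on {0<..<T}"
  interpret finite_measure ?M by (rule finite_measure_interval)
  have m: "measure ?M (space ?M) = T"
    using T by (simp add: measure_restrict_space)
  note gi = sq_integrable_imp_integrable[OF g]
  define I where "I = (\<integral>t. norm (g t) \<partial>?M)"
  have le: "(norm c)\<^sup>2 \<le> 2 * (norm (primitive c g t))\<^sup>2 + 2 * I\<^sup>2" if t: "t \<in> {0<..<T}" for t
  proof -
    have "norm (integral {0..t} g) = norm (\<integral>s. (if s \<le> t then g s else 0) \<partial>?M)"
      using integral_prefix_eq(1)[OF gi t] by simp
    also have "\<dots> \<le> (\<integral>s. norm (if s \<le> t then g s else 0) \<partial>?M)" by (rule integral_norm_bound)
    also have "\<dots> \<le> I"
      unfolding I_def
      by (rule integral_mono) (use integrable_restrict_if[OF gi measurable_pred_le_lebesgue_on(1)] gi in auto)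
    finally have n: "norm (integral {0..t} g) \<le> I" .
    have "(norm c)\<^sup>2 \<le> 2 * (norm (primitive c g t))\<^sup>2 + 2 * (norm (integral {0..t} g))\<^sup>2"
      using norm_add_sq_le[of "primitive c g t" "- integral {0..t} g"] by (simp add: primitive_def)
    then show ?thesis using power_mono[OF n norm_ge_zero, of 2] by simp
  qed
  note p2 = sq_integrableD(2)[OF sq_integrable_primitive[OF g, of c]]
  have "(\<integral>t. (norm c)\<^sup>2 \<partial>?M) \<le> (\<integral>t. 2 * (norm (primitive c g t))\<^sup>2 + 2 * I\<^sup>2 \<partial>?M)"
    by (rule integral_mono) (use le p2 in auto)
  then have "T * (norm c)\<^sup>2 \<le> 2 * sq_norm T (primitive c g) + T * (2 * I\<^sup>2)"
    using p2 m by (simp add: sq_norm_def)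
  also have "I\<^sup>2 \<le> T * sq_norm T g" unfolding I_def by (rule integral_norm_square_le[OF T g])
  finally have "T * (norm c)\<^sup>2 \<le> 2 * sq_norm T (primitive c g) + T * (2 * (T * sq_norm T g))"
    using T by simp
  then have "(norm c)\<^sup>2 \<le> 2 / T * sq_norm T (primitive c g) + 2 * T * sq_norm T g"
    using T by (simp add: field_simps power2_eq_square)
  also have "\<dots> \<le> (2 / T + 2 * T) * (sq_norm T (primitive c g) + sq_norm T g)"
    using T by (simp add: algebra_simps)
  finally show ?thesis .
qed

lemma sq_norm_add_le:
  assumes "f \<in> sq_integrable T" "g \<in> sq_integrable T"
  shows "sq_norm T (\<lambda>t. f t + g t) \<le> 2 * sq_norm T f + 2 * sq_norm T g"
proof -
  have "sq_norm T (\<lambda>t. f t + g t) \<le> (\<integral>t. 2 * (norm (f t))\<^sup>2 + 2 * (norm (g t))\<^sup>2 \<partial>lebesgue_on {0<..<T})"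
    unfolding sq_norm_def
    by (rule integral_mono)
       (use sq_integrableD(2)[OF sq_integrable_add[OF assms]] assms[THEN sq_integrableD(2)] norm_add_sq_le in auto)
  then show ?thesis using assms[THEN sq_integrableD(2)] by (simp add: sq_norm_def)
qed

lemma sq_norm_scale: "sq_norm T (\<lambda>t. a *\<^sub>R f t) = a\<^sup>2 * sq_norm T f"
  unfolding sq_norm_def by (simp add: power_mult_distrib)

lemma sq_norm_diff_le:
  assumes "f \<in> sq_integrable T" "g \<in> sq_integrable T"
  shows "sq_norm T (\<lambda>t. f t - g t) \<le> 2 * sq_norm T f + 2 * sq_norm T g"
  using sq_norm_add_le[OF assms(1) sq_integrable_scaleR[OF assms(2), of "-1"]]
    sq_norm_scale[of T "-1" g] by simp

lemma sq_norm_matrix_le: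
  fixes F :: "real^'n^'m"
  assumes "f \<in> sq_integrable T"
  shows "sq_norm T (\<lambda>t. F *v f t) \<le> (onorm ((*v) F))\<^sup>2 * sq_norm T f"
proof -
  have "sq_norm T (\<lambda>t. F *v f t) \<le> (\<integral>t. (onorm ((*v) F))\<^sup>2 * (norm (f t))\<^sup>2 \<partial>lebesgue_on {0<..<T})"
    unfolding sq_norm_def
  proof (rule integral_mono)
    show "(norm (F *v f t))\<^sup>2 \<le> (onorm ((*v) F))\<^sup>2 * (norm (f t))\<^sup>2" for t
      using power_mono[OF onorm[OF matrix_vector_mul_bounded_linear] norm_ge_zero, of F "f t" 2]
      by (simp add: power_mult_distrib)
  qed (use sq_integrableD(2)[OF sq_integrable_matrix[OF assms]] sq_integrableD(2)[OF assms] in auto)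
  then show ?thesis by (simp add: sq_norm_def)
qed

text \<open>Let \<open>x = primitive c g\<close> and \<open>f = g - F x\<close>. The energy identity for a Lyapunov form \<open>b\<close> gives
  \<open>b (x T) (x T) - b c c = \<integral> 2 b x (F x) + 2 b x f \<le> \<integral> - \<parallel>x\<parallel>\<^sup>2 + 2 M \<parallel>x\<parallel> \<parallel>f\<parallel>\<close>. Half of \<open>\<parallel>x\<parallel>\<^sup>2\<close> absorbs the
  mixed term, and the end value is dropped because \<open>b\<close> is positive semidefinite. No constant in the
  resulting bound depends on \<open>T\<close>.\<close>

lemma energy_estimate:
  fixes F :: "real^'n^'n"
  assumes "\<omega>\<^sub>0 F < 0"
  obtains C where "C > 0"
    "\<And>T c g. T > 0 \<Longrightarrow> g \<in> sq_integrable T \<Longrightarrow>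
      sq_norm T (primitive c g) + sq_norm T g
      \<le> C * (sq_norm T (\<lambda>t. g t - F *v primitive c g t) + (norm c)\<^sup>2)"
proof -
  obtain b where b: "bounded_bilinear b" "\<And>x y. b x y = b y x" "\<And>x. 0 \<le> b x x"
    "\<And>x. 2 * b x (F *v x) \<le> - (norm x)\<^sup>2"
    using lyapunov_form[OF assms] by blast
  interpret b: bounded_bilinear b by fact
  obtain M where M: "M > 0" "\<And>x y. norm (b x y) \<le> norm x * norm y * M" using b.pos_bounded by blast
  define N where "N = onorm ((*v) F)"
  \<comment> \<open>\<open>D\<close> is the constant for \<open>x\<close> alone; \<open>C\<close> adds the derivative through \<open>g = F x + f\<close>\<close>
  define D where "D = 2 * M + 4 * M\<^sup>2"
  define C where "C = (1 + 2 * N\<^sup>2) * D + 2"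
  have D: "D > 0" using M by (simp add: D_def add_pos_nonneg)
  then have C: "C > 0" by (simp add: C_def add_nonneg_pos)
  have "sq_norm T (primitive c g) + sq_norm T g
      \<le> C * (sq_norm T (\<lambda>t. g t - F *v primitive c g t) + (norm c)\<^sup>2)"
    if T: "T > 0" and g: "g \<in> sq_integrable T" for T c g
  proof -
    let ?M = "lebesgue_on {0<..<T}"
    let ?x = "primitive c g"
    define f where "f = (\<lambda>t. g t - F *v ?x t)"
    have x: "?x \<in> sq_integrable T" by (rule sq_integrable_primitive[OF g])
    have Fx: "(\<lambda>t. F *v ?x t) \<in> sq_integrable T" by (rule sq_integrable_matrix[OF x])
    have f: "f \<in> sq_integrable T" unfolding f_def by (rule sq_integrable_diff[OF g Fx])
    note gi = sq_integrable_imp_integrable[OF g]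
    note parts = integral_by_parts_primitive(1)[OF b(1) gi gi, of c]
      integral_by_parts_primitive(2)[OF b(1) gi gi, of c]
      integral_by_parts_primitive(3)[OF b(1) gi gi, of c c]
    have pt: "b (?x t) (g t) + b (g t) (?x t) \<le> - (norm (?x t))\<^sup>2 / 2 + 2 * M\<^sup>2 * (norm (f t))\<^sup>2" for t
    proof -
      have "b (?x t) (g t) + b (g t) (?x t) = 2 * b (?x t) (F *v ?x t) + 2 * b (?x t) (f t)"
        unfolding b(2)[of "g t"] by (simp add: f_def b.diff_right)
      also have "\<dots> \<le> - (norm (?x t))\<^sup>2 + 2 * (norm (?x t) * norm (f t) * M)"
        using b(4)[of "?x t"] M(2)[of "?x t" "f t"] by simp
      also have "\<dots> \<le> - (norm (?x t))\<^sup>2 / 2 + 2 * M\<^sup>2 * (norm (f t))\<^sup>2"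
        using zero_le_power2[of "norm (?x t) - 2 * M * norm (f t)"]
        by (simp add: power2_eq_square algebra_simps)
      finally show ?thesis .
    qed
    have "- b c c \<le> b (?x T) (?x T) - b c c" using b(3) by simp
    also have "\<dots> = (\<integral>t. b (?x t) (g t) + b (g t) (?x t) \<partial>?M)"
      using parts by simp
    also have "\<dots> \<le> (\<integral>t. - (norm (?x t))\<^sup>2 / 2 + 2 * M\<^sup>2 * (norm (f t))\<^sup>2 \<partial>?M)"
      by (rule integral_mono) (use pt parts(1,2) sq_integrableD(2)[OF x] sq_integrableD(2)[OF f] in auto)
    also have "\<dots> = - sq_norm T ?x / 2 + 2 * M\<^sup>2 * sq_norm T f"
      using sq_integrableD(2)[OF x] sq_integrableD(2)[OF f] by (simp add: sq_norm_def)
    finally have "sq_norm T ?x \<le> 2 * b c c + 4 * M\<^sup>2 * sq_norm T f" by simp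
    also have "b c c \<le> M * (norm c)\<^sup>2"
      using M(2)[of c c] by (simp add: power2_eq_square mult.commute)
    finally have "sq_norm T ?x \<le> 2 * M * (norm c)\<^sup>2 + 4 * M\<^sup>2 * sq_norm T f" by simp
    also have "\<dots> \<le> D * (sq_norm T f + (norm c)\<^sup>2)"
      using M(1) by (simp add: D_def algebra_simps)
    finally have 1: "sq_norm T ?x \<le> D * (sq_norm T f + (norm c)\<^sup>2)" .
    have "sq_norm T g = sq_norm T (\<lambda>t. F *v ?x t + f t)" by (simp add: f_def)
    also have "\<dots> \<le> 2 * sq_norm T (\<lambda>t. F *v ?x t) + 2 * sq_norm T f" by (rule sq_norm_add_le[OF Fx f])
    also have "\<dots> \<le> 2 * (N\<^sup>2 * sq_norm T ?x) + 2 * sq_norm T f"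
      using sq_norm_matrix_le[OF x, of F] by (simp add: N_def)
    finally have "sq_norm T ?x + sq_norm T g \<le> (1 + 2 * N\<^sup>2) * sq_norm T ?x + 2 * sq_norm T f"
      by (simp add: algebra_simps)
    also have "\<dots> \<le> (1 + 2 * N\<^sup>2) * (D * (sq_norm T f + (norm c)\<^sup>2)) + 2 * (sq_norm T f + (norm c)\<^sup>2)"
      by (intro add_mono mult_left_mono 1) auto
    also have "\<dots> = C * (sq_norm T f + (norm c)\<^sup>2)" by (simp add: C_def algebra_simps)
    finally show ?thesis unfolding f_def .
  qed
  with C show thesis by (rule that)
qed

section \<open>The feedbacked state operator\<close>

lemma L2_times_norm: "vs_norm (L2_times T) (X, a) = sqrt ((vs_norm (L2 T) X)\<^sup>2 + (norm a)\<^sup>2)"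
  by (simp add: L2_times_def)

lemma L2_times_norm_cls:
  "f \<in> sq_integrable T \<Longrightarrow> vs_norm (L2_times T) (cls T f, a) = sqrt (sq_norm T f + (norm a)\<^sup>2)"
  by (simp add: L2_times_norm L2_norm_cls)

lemma L2_times_diff:
  "vs_diff (L2_times T) (X, a) (Y, b) = (vs_diff (L2 T) X Y, a - b)"
  by (simp add: vs_diff_def L2_times_def)

lemma feedbacked_state_op_primitive:
  fixes A :: "real^'n^'n" and B :: "real^'m^'n" and K :: "real^'n^'m"
  assumes T: "T > 0" and g: "g \<in> sq_integrable T"
  shows "feedbacked_state_op T A B K (cls T (primitive c g))
    = (cls T (\<lambda>t. g t - (A + B ** K) *v primitive c g t), c)"
proof -
  let ?x = "primitive c g"
  note x = sq_integrable_primitive[OF g, of c]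
  note sq = sq_integrable_matrix sq_integrable_diff x g
  have "feedbacked_state_op T A B K (cls T ?x) = (cls T (\<lambda>t. g t - A *v ?x t - B *v (K *v ?x t)), c)"
    unfolding feedbacked_state_op_def state_op_def input_op_def feedback_op_def
      weak_deriv_primitive[OF T g] initial_value_primitive[OF T g] L2_times_diff
    by (simp add: matrix_op_cls L2_diff_cls sq)
  also have "(\<lambda>t. g t - A *v ?x t - B *v (K *v ?x t)) = (\<lambda>t. g t - (A + B ** K) *v ?x t)"
    by (simp add: matrix_vector_mult_add_rdistrib matrix_vector_mul_assoc algebra_simps)
  finally show ?thesis .
qed

text \<open>A lower bound for \<open>F\<close> is an upper bound for its inverse, and the inverse of a linear bijection is
  linear.\<close>

lemma boundedly_invertibleI:
  assumes F: "bounded_operator V W F" and bij: "bij_betw F (vs_carrier V) (vs_carrier W)"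
    and add: "\<And>x y. x \<in> vs_carrier V \<Longrightarrow> y \<in> vs_carrier V \<Longrightarrow> vs_add V x y \<in> vs_carrier V"
    and scale: "\<And>a x. x \<in> vs_carrier V \<Longrightarrow> vs_scale V a x \<in> vs_carrier V"
    and bound: "\<And>x. x \<in> vs_carrier V \<Longrightarrow> vs_norm V x \<le> C * vs_norm W (F x)"
  shows "boundedly_invertible V W F"
proof -
  let ?G = "operator_inv V F"
  have G: "?G w \<in> vs_carrier V" "F (?G w) = w" if "w \<in> vs_carrier W" for w
    using bij that unfolding operator_inv_def bij_betw_def
    by (auto intro: inv_into_into f_inv_into_f)
  have GF: "?G (F x) = x" if "x \<in> vs_carrier V" for x
    using bij that unfolding operator_inv_def bij_betw_def by auto
  have "bounded_operator W V ?G"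
    unfolding bounded_operator_def
  proof (intro conjI ballI allI exI[of _ C])
    show "?G \<in> vs_carrier W \<rightarrow> vs_carrier V" using G by blast
    show "?G (vs_add W u w) = vs_add V (?G u) (?G w)" if "u \<in> vs_carrier W" "w \<in> vs_carrier W" for u w
    proof -
      have "F (vs_add V (?G u) (?G w)) = vs_add W u w"
        using F G that unfolding bounded_operator_def by simp
      then show ?thesis using GF[OF add[OF G(1) G(1)]] that by metis
    qed
    show "?G (vs_scale W a w) = vs_scale V a (?G w)" if "w \<in> vs_carrier W" for a w
    proof -
      have "F (vs_scale V a (?G w)) = vs_scale W a w"
        using F G that unfolding bounded_operator_def by simp
      then show ?thesis using GF[OF scale[OF G(1)]] that by metis
    qed
    show "vs_norm V (?G w) \<le> C * vs_norm W w" if "w \<in> vs_carrier W" for w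
      using bound[OF G(1)[OF that]] G(2)[OF that] by simp
  qed
  then show ?thesis using bij by (simp add: boundedly_invertible_def)
qed

lemma operator_norm_inv_le:
  assumes bij: "bij_betw F (vs_carrier V) (vs_carrier W)" and C: "0 \<le> C"
    and bound: "\<And>x. x \<in> vs_carrier V \<Longrightarrow> vs_norm V x \<le> C * vs_norm W (F x)"
    and ne: "w0 \<in> vs_carrier W" "vs_norm W w0 \<le> 1"
  shows "operator_norm W V (operator_inv V F) \<le> C"
  unfolding operator_norm_def
proof (rule cSUP_least)
  fix w assume w: "w \<in> {x \<in> vs_carrier W. vs_norm W x \<le> 1}"
  then have G: "operator_inv V F w \<in> vs_carrier V" "F (operator_inv V F w) = w"
    using bij unfolding operator_inv_def bij_betw_def by (auto intro: inv_into_into f_inv_into_f)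
  have "vs_norm V (operator_inv V F w) \<le> C * vs_norm W w" using bound[OF G(1)] G(2) by simp
  also have "\<dots> \<le> C * 1" using w C by (intro mult_left_mono) auto
  finally show "vs_norm V (operator_inv V F w) \<le> C" by simp
qed (use ne in blast)

lemma bounded_operator_feedbacked_state_op:
  fixes A :: "real^'n^'n" and B :: "real^'m^'n" and K :: "real^'n^'m"
  assumes T: "T > 0"
  shows "bounded_operator (H1 T) (L2_times T) (feedbacked_state_op T A B K)"
proof -
  let ?F = "A + B ** K" and ?O = "feedbacked_state_op T A B K"
  define N where "N = onorm ((*v) ?F)"
  define C where "C = 2 + 2 * N\<^sup>2 + (2 / T + 2 * T)"
  note O = feedbacked_state_op_primitive[OF T, of _ A B K]
  have res: "(\<lambda>t. g t - ?F *v primitive c g t) \<in> sq_integrable T" if "g \<in> sq_integrable T" for g c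
    using that by (intro sq_integrable_diff sq_integrable_matrix sq_integrable_primitive)
  show ?thesis
    unfolding bounded_operator_def
  proof (intro conjI ballI allI exI[of _ "sqrt C"])
    show "?O \<in> vs_carrier (H1 T) \<rightarrow> vs_carrier (L2_times T)"
      by (auto elim!: H1_cases[OF T] simp: O L2_times_def cls_in_L2 res)
    show "?O (vs_add (H1 T) X Y) = vs_add (L2_times T) (?O X) (?O Y)"
      if XY: "X \<in> vs_carrier (H1 T)" "Y \<in> vs_carrier (H1 T)" for X Y
    proof -
      obtain c g where X: "g \<in> sq_integrable T" "X = cls T (primitive c g)" by (rule H1_cases[OF T XY(1)])
      obtain d h where Y: "h \<in> sq_integrable T" "Y = cls T (primitive d h)" by (rule H1_cases[OF T XY(2)])
      have "cls T (\<lambda>t. g t + h t - ?F *v primitive (c + d) (\<lambda>t. g t + h t) t)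
        = cls T (\<lambda>t. (g t - ?F *v primitive c g t) + (h t - ?F *v primitive d h t))"
      proof (rule cls_eqI)
        fix t assume "t \<in> {0<..<T}"
        from primitive_add[OF X(1) Y(1) this, of c d, symmetric]
        show "g t + h t - ?F *v primitive (c + d) (\<lambda>t. g t + h t) t
          = (g t - ?F *v primitive c g t) + (h t - ?F *v primitive d h t)"
          by (simp add: matrix_vector_right_distrib)
      qed (intro res sq_integrable_add X Y)+
      then show ?thesis
        unfolding X(2) Y(2) H1_add_primitive[OF X(1) Y(1)] O[OF X(1)] O[OF Y(1)] O[OF sq_integrable_add[OF X(1) Y(1)]]
        by (simp add: L2_times_def L2_add_cls res X Y)
    qed
    show "?O (vs_scale (H1 T) a X) = vs_scale (L2_times T) a (?O X)" if XH: "X \<in> vs_carrier (H1 T)" for a X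
    proof -
      obtain c g where X: "g \<in> sq_integrable T" "X = cls T (primitive c g)" by (rule H1_cases[OF T XH])
      show ?thesis
        unfolding X(2) H1_scale_primitive[OF X(1)] O[OF X(1)] O[OF sq_integrable_scaleR[OF X(1)]]
        by (simp add: L2_times_def L2_scale_cls res X scaleR_right_diff_distrib primitive_scaleR[symmetric] matrix_vector_mult_scaleR)
    qed
    show "vs_norm (L2_times T) (?O X) \<le> sqrt C * vs_norm (H1 T) X" if XH: "X \<in> vs_carrier (H1 T)" for X
    proof -
      obtain c g where X: "g \<in> sq_integrable T" "X = cls T (primitive c g)" by (rule H1_cases[OF T XH])
      let ?x = "primitive c g"
      note x = sq_integrable_primitive[OF X(1), of c]
      have "sq_norm T (\<lambda>t. g t - ?F *v ?x t) \<le> 2 * sq_norm T g + 2 * sq_norm T (\<lambda>t. ?F *v ?x t)"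
        by (rule sq_norm_diff_le[OF X(1) sq_integrable_matrix[OF x]])
      also have "\<dots> \<le> 2 * sq_norm T g + 2 * (N\<^sup>2 * sq_norm T ?x)"
        using sq_norm_matrix_le[OF x, of ?F] by (simp add: N_def)
      also have "\<dots> \<le> (2 + 2 * N\<^sup>2) * (sq_norm T ?x + sq_norm T g)"
        by (simp add: algebra_simps)
      finally have "sq_norm T (\<lambda>t. g t - ?F *v ?x t) + (norm c)\<^sup>2 \<le> C * (sq_norm T ?x + sq_norm T g)"
        using initial_value_bound[OF T X(1), of c] by (simp add: C_def distrib_right)
      then show ?thesis
        unfolding X(2) O[OF X(1)] L2_times_norm_cls[OF res[OF X(1)]] H1_norm_primitive[OF T X(1)]
        by (simp add: real_sqrt_mult[symmetric])
    qed
  qed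
qed

text \<open>Injectivity comes from the estimate, applied to the difference of two preimages. For surjectivity the
  equation \<open>x' = F x + f\<close>, \<open>x(0) = c\<close> is integrated once, which turns it into a Volterra equation with
  continuous data, and \<open>F x + f\<close> is the weak derivative of its solution.\<close>

lemma bij_betw_feedbacked_state_op:
  fixes A :: "real^'n^'n" and B :: "real^'m^'n" and K :: "real^'n^'m"
  assumes T: "T > 0"
    and est: "\<And>c g. g \<in> sq_integrable T \<Longrightarrow> sq_norm T (primitive c g) + sq_norm T g
      \<le> C * (sq_norm T (\<lambda>t. g t - (A + B ** K) *v primitive c g t) + (norm c)\<^sup>2)"
  shows "bij_betw (feedbacked_state_op T A B K) (vs_carrier (H1 T)) (vs_carrier (L2_times T))"
proof -
  let ?F = "A + B ** K" and ?O = "feedbacked_state_op T A B K"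
  note O = feedbacked_state_op_primitive[OF T, of _ A B K]
  have res: "(\<lambda>t. g t - ?F *v primitive c g t) \<in> sq_integrable T" if "g \<in> sq_integrable T" for g c
    using that by (intro sq_integrable_diff sq_integrable_matrix sq_integrable_primitive)
  have "inj_on ?O (vs_carrier (H1 T))"
  proof (rule inj_onI)
    fix X Y assume XY: "X \<in> vs_carrier (H1 T)" "Y \<in> vs_carrier (H1 T)" "?O X = ?O Y"
    obtain c g where X: "g \<in> sq_integrable T" "X = cls T (primitive c g)" by (rule H1_cases[OF T XY(1)])
    obtain d h where Y: "h \<in> sq_integrable T" "Y = cls T (primitive d h)" by (rule H1_cases[OF T XY(2)])
    have cd: "c = d" and ae: "AE t in lebesgue_on {0<..<T}. g t - ?F *v primitive c g t = h t - ?F *v primitive d h t"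
      using XY(3) unfolding X(2) Y(2) O[OF X(1)] O[OF Y(1)] by (auto simp: cls_eq_iff res X(1) Y(1))
    define k where "k = (\<lambda>t. g t - h t)"
    have k: "k \<in> sq_integrable T" unfolding k_def by (rule sq_integrable_diff[OF X(1) Y(1)])
    have pk: "primitive c g t = primitive 0 k t + primitive d h t" if "t \<in> {0<..<T}" for t
      using primitive_add[OF k Y(1) that, of 0 d] cd by (simp add: k_def)
    have "AE t in lebesgue_on {0<..<T}. k t - ?F *v primitive 0 k t = 0"
      using ae AE_space
    proof eventually_elim
      case (elim t)
      then have "?F *v primitive c g t = ?F *v primitive 0 k t + ?F *v primitive d h t"
        using pk[of t] by (simp add: matrix_vector_right_distrib)
      with elim show ?case by (simp add: k_def algebra_simps)
    qed
    then have "sq_norm T (\<lambda>t. k t - ?F *v primitive 0 k t) = sq_norm T (\<lambda>t. 0 :: real^'n)"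
      by (rule sq_norm_cong_AE[OF res[OF k] sq_integrable_continuous[OF continuous_on_const]])
    then have "sq_norm T (primitive 0 k) + sq_norm T k \<le> 0"
      using est[OF k, of 0] by (simp add: sq_norm_def)
    then have "sq_norm T (primitive 0 k) = 0"
      using sq_norm_nonneg[of T k] sq_norm_nonneg[of T "primitive 0 k"] by linarith
    then have "AE t in lebesgue_on {0<..<T}. (norm (primitive 0 k t))\<^sup>2 = 0"
      unfolding sq_norm_def
      by (subst (asm) integral_nonneg_eq_0_iff_AE) (use sq_integrableD(2)[OF sq_integrable_primitive[OF k]] in auto)
    then have "AE t in lebesgue_on {0<..<T}. primitive c g t = primitive d h t"
      using AE_space by eventually_elim (simp add: pk)
    then show "X = Y" unfolding X(2) Y(2)
      by (simp add: cls_eq_iff sq_integrable_primitive X(1) Y(1))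
  qed
  moreover have "?O ` vs_carrier (H1 T) = vs_carrier (L2_times T)"
  proof
    show "?O ` vs_carrier (H1 T) \<subseteq> vs_carrier (L2_times T)"
      using bounded_operator_feedbacked_state_op[OF T, of A B K] by (auto simp: bounded_operator_def)
    show "vs_carrier (L2_times T) \<subseteq> ?O ` vs_carrier (H1 T)"
    proof
      fix w assume "w \<in> vs_carrier (L2_times T :: ((real \<Rightarrow> real^'n) set \<times> (real^'n)) nvs)"
      then obtain X c where "w = (X, c)" "X \<in> vs_carrier (L2 T)" by (auto simp: L2_times_def)
      then obtain f where f: "f \<in> sq_integrable T" and w: "w = (cls T f, c)" by (metis L2_cases)
      note fi = sq_integrable_imp_integrable[OF f]
      obtain x where x: "continuous_on {0..T} x"
        "\<And>t. t \<in> {0..T} \<Longrightarrow> x t = primitive c f t + integral {0..t} (\<lambda>s. ?F *v x s)"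
        using volterra[OF T matrix_vector_mul_bounded_linear[of ?F] continuous_on_primitive[OF fi, of c]] by blast
      define g where "g = (\<lambda>t. f t + ?F *v x t)"
      have Fx: "(\<lambda>t. ?F *v x t) \<in> sq_integrable T"
        by (rule sq_integrable_matrix[OF sq_integrable_continuous[OF x(1)]])
      have g: "g \<in> sq_integrable T" unfolding g_def by (rule sq_integrable_add[OF f Fx])
      have px: "primitive c g t = x t" if "t \<in> {0<..<T}" for t
        using primitive_add[OF f Fx that, of c 0] x(2)[of t] that by (simp add: g_def primitive_def)
      have "cls T (\<lambda>t. g t - ?F *v primitive c g t) = cls T f"
        by (rule cls_eqI[OF res[OF g] f]) (simp add: px, simp add: g_def)
      then have "?O (cls T (primitive c g)) = w" by (simp add: O[OF g] w)
      then show "w \<in> ?O ` vs_carrier (H1 T)" using primitive_in_H1[OF T g, of c] by blast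
    qed
  qed
  ultimately show ?thesis by (simp add: bij_betw_def)
qed

theorem corollary4p3:
  fixes A :: "real^'n^'n" and B :: "real^'m^'n"
  assumes "exp_stabilizable A B"
  shows "\<forall>K :: real^'n^'m. \<omega>\<^sub>0 (A + B ** K) < 0 \<longrightarrow>
    (\<forall>T>0.
       (\<forall>x\<in>vs_carrier (H1 T).
          feedbacked_state_op T A B K x =
            (vs_diff (L2 T) (weak_deriv T x) (matrix_op T (A + B ** K) x), initial_value T x)) \<and>
       bounded_operator (H1 T) (L2_times T) (feedbacked_state_op T A B K) \<and>
       boundedly_invertible (H1 T) (L2_times T) (feedbacked_state_op T A B K)) \<and>
    (\<exists>c>0. \<forall>T>0.
       operator_norm (L2_times T) (H1 T)
         (operator_inv (H1 T) (feedbacked_state_op T A B K)) \<le> c)"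
proof (intro allI impI)
  fix K :: "real^'n^'m"
  let ?F = "A + B ** K" and ?O = "\<lambda>T. feedbacked_state_op T A B K"
  assume "\<omega>\<^sub>0 ?F < 0"
  then obtain C where C: "C > 0"
    "\<And>T c g. T > 0 \<Longrightarrow> g \<in> sq_integrable T \<Longrightarrow> sq_norm T (primitive c g) + sq_norm T g
      \<le> C * (sq_norm T (\<lambda>t. g t - ?F *v primitive c g t) + (norm c)\<^sup>2)"
    using energy_estimate[of ?F] by blast
  have res: "(\<lambda>t. g t - ?F *v primitive c g t) \<in> sq_integrable T" if "g \<in> sq_integrable T" for g c T
    using that by (intro sq_integrable_diff sq_integrable_matrix sq_integrable_primitive)
  have bij: "bij_betw (?O T) (vs_carrier (H1 T)) (vs_carrier (L2_times T))" if "T > 0" for T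
    by (rule bij_betw_feedbacked_state_op[OF that C(2)[OF that]])
  have bound: "vs_norm (H1 T) X \<le> sqrt C * vs_norm (L2_times T) (?O T X)"
    if T: "T > 0" and XH: "X \<in> vs_carrier (H1 T)" for T X
  proof -
    obtain c g where X: "g \<in> sq_integrable T" "X = cls T (primitive c g)" by (rule H1_cases[OF T XH])
    show ?thesis
      unfolding X(2) feedbacked_state_op_primitive[OF T X(1)] L2_times_norm_cls[OF res[OF X(1)]]
        H1_norm_primitive[OF T X(1)]
      using C(2)[OF T X(1), of c] by (simp add: real_sqrt_mult[symmetric])
  qed
  show "(\<forall>T>0.
       (\<forall>x\<in>vs_carrier (H1 T).
          feedbacked_state_op T A B K x =
            (vs_diff (L2 T) (weak_deriv T x) (matrix_op T (A + B ** K) x), initial_value T x)) \<and>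
       bounded_operator (H1 T) (L2_times T) (feedbacked_state_op T A B K) \<and>
       boundedly_invertible (H1 T) (L2_times T) (feedbacked_state_op T A B K)) \<and>
    (\<exists>c>0. \<forall>T>0.
       operator_norm (L2_times T) (H1 T)
         (operator_inv (H1 T) (feedbacked_state_op T A B K)) \<le> c)"
  proof (intro conjI allI impI ballI exI[of _ "sqrt C"])
    fix T :: real assume T: "T > 0"
    show "?O T X = (vs_diff (L2 T) (weak_deriv T X) (matrix_op T ?F X), initial_value T X)"
      if XH: "X \<in> vs_carrier (H1 T)" for X
    proof -
      obtain c g where X: "g \<in> sq_integrable T" "X = cls T (primitive c g)" by (rule H1_cases[OF T XH])
      show ?thesis
        unfolding X(2) feedbacked_state_op_primitive[OF T X(1)]
        by (simp add: weak_deriv_primitive initial_value_primitive matrix_op_cls L2_diff_cls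
            T X(1) sq_integrable_primitive sq_integrable_matrix)
    qed
    show "bounded_operator (H1 T) (L2_times T) (?O T)" by (rule bounded_operator_feedbacked_state_op[OF T])
    show "boundedly_invertible (H1 T) (L2_times T) (?O T)"
    proof (rule boundedly_invertibleI[OF bounded_operator_feedbacked_state_op[OF T] bij[OF T] _ _ bound[OF T]])
      show "vs_add (H1 T) X Y \<in> vs_carrier (H1 T)"
        if "X \<in> vs_carrier (H1 T)" "Y \<in> vs_carrier (H1 T)" for X Y :: "(real \<Rightarrow> real^'n) set"
        using that by (auto elim!: H1_cases[OF T] simp: H1_add_primitive primitive_in_H1 sq_integrable_add T)
      show "vs_scale (H1 T) a X \<in> vs_carrier (H1 T)"
        if "X \<in> vs_carrier (H1 T)" for a and X :: "(real \<Rightarrow> real^'n) set"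
        using that by (auto elim!: H1_cases[OF T] simp: H1_scale_primitive primitive_in_H1 sq_integrable_scaleR T)
    qed
    have z: "(\<lambda>_. 0 :: real^'n) \<in> sq_integrable T" by (rule sq_integrable_continuous[OF continuous_on_const])
    show "operator_norm (L2_times T) (H1 T) (operator_inv (H1 T) (?O T)) \<le> sqrt C"
    proof (rule operator_norm_inv_le[OF bij[OF T] _ bound[OF T]])
      show "(cls T (\<lambda>_. 0 :: real^'n), 0) \<in> vs_carrier (L2_times T)" by (simp add: L2_times_def cls_in_L2 z)
      show "vs_norm (L2_times T) (cls T (\<lambda>_. 0 :: real^'n), 0) \<le> 1"
        unfolding L2_times_norm_cls[OF z] by (simp add: sq_norm_def)
    qed (use C in auto)
  qed (use C in auto)
qed

end
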